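(* Let $n\ge1$, $\beta>0$ and $\gamma>0$. Let $\Omega\subset\mathbf{R}^n$ be a bounded open set with $C^1$ boundary, and assume that its outward unit normal vector field (defined on $\partial\Omega$) has a continuous extension $\nu\colon\mathbf{R}^n\setminus\Omega\to\mathbf{R}^n$ such that $|\nu|\le 1$ and such that $\nu$ is divergence-free on $\mathbf{R}^n\setminus\overline{\Omega}$ in the sense of distributions. If $\beta\le\gamma$, then the indicator function $\mathbf{1}_\Omega$ has a calibration.
   Context: Fix parameters $\beta,\gamma>0$. The problem under consideration is the minimization of $E(u)=\int|\nabla u|^2\,\mathrm{d}x+\beta\int_{J_u}\big((u^+)^2+(u^-)^2\big)\,\mathrm{d}\mathcal{H}^{n-1}+\gamma^2\mathcal{L}^n(\{u>0\})$ among $u\in SBV(\mathbf{R}^n)$ with $u=1$ on $\Omega$ and $0\le u\le1$. Jump set: for $u\in SBV(\mathbf{R}^n)$, $J_u$ is the set of jump points of $u$, i.e. points $x$ for which there are real numbers $u^-(x)<u^+(x)$ and a unit vector $\nu_u(x)$ such that $u$ has approximate limit (in the $L^1$-average sense on half-balls centred at $x$, as the radius tends to $0$) $u^+(x)$ on the side $\{(y-x)\cdot\nu_u(x)>0\}$ and $u^-(x)$ on the side $\{(y-x)\cdot\nu_u(x)<0\}$; thus $\nu_u$ points toward the higher trace. Approximately regular: for $D\subset\mathbf{R}^n\times\mathbf{R}$, a bounded Borel vector field $\phi\colon D\to\mathbf{R}^n\times\mathbf{R}$ is approximately regular on $D$ if for every Lipschitz hypersurface $S\subset\mathbf{R}^n\times\mathbf{R}$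 with unit normal $\nu_S$, for $\mathcal{H}^n$-a.e. $z_0\in S\cap D$, the function $z\mapsto\phi(z)\cdot\nu_S(z_0)$, $z\in D$, has approximate limit $\phi(z_0)\cdot\nu_S(z_0)$ at $z_0$ (i.e. for every $\varepsilon>0$ the set $\{z\in D:|(\phi(z)-\phi(z_0))\cdot\nu_S(z_0)|>\varepsilon\}$ has Lebesgue density $0$ at $z_0$). Calibration: let $\Omega$ be a bounded open set of $\mathbf{R}^n$ with Lipschitz boundary and let $u\in SBV(\mathbf{R}^n)$ have compact support, with $u=1$ on $\Omega$ and $0\le u\le1$ in $\mathbf{R}^n$. A calibration for $u$ is a Borel map $\phi=(\phi^x,\phi^t)\colon(\mathbf{R}^n\setminus\Omega)\times[0,1]\to\mathbf{R}^n\times\mathbf{R}$ which is bounded and approximately regular on $(\mathbf{R}^n\setminus\Omega)\times[0,1]$, divergence-free on $(\mathbf{R}^n\setminus\overline{\Omega})\times\,]0,1[$ in the sense of distributions, and such that (a) $\phi^t(x,t)\ge\frac14|\phi^x(x,t)|^2-\gamma^2\mathbf{1}_{\{t>0\}}(t)$ for $\mathcal{L}^n$-a.e. $x\in\mathbf{R}^n\setminus\overline{\Omega}$ and every $t\in[0,1]$; (b) $\left|\int_r^s\phi^x(x,t)\,\mathrm{d}t\right|\le\beta(r^2+s^2)$ for $\mathcal{H}^{n-1}$-a.e. $x\in\mathbf{R}^n\setminus\Omega$ and every $r,s\in[0,1]$; (a') $\phi^x(x,u(x))=2\nabla u(x)$ and $\phi^t(x,u(x))=|\nabla u(x)|^2-\gamma^2\mathbf{1}_{\{t>0\}}(u(x))$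 for $\mathcal{L}^n$-a.e. $x\in\mathbf{R}^n\setminus\overline{\Omega}$; (b') $\int_{u^-}^{u^+}\phi^x(x,t)\,\mathrm{d}t=\beta\left[(u^-)^2+(u^+)^2\right]\nu_u$ for $\mathcal{H}^{n-1}$-a.e. $x\in J_u$. *)

theory Defs
  imports "HOL-Analysis.Analysis"
begin

section \<open>Differentiability classes and test functions\<close>

primrec Ck :: "nat \<Rightarrow> ('a::euclidean_space \<Rightarrow> real) \<Rightarrow> bool" where
  "Ck 0 f = continuous_on UNIV f"
| "Ck (Suc k) f = ((\<forall>x. f differentiable (at x)) \<and>
     (\<forall>e\<in>Basis. Ck k (\<lambda>x. frechet_derivative f (at x) e)))"

definition test_functions :: "'a::euclidean_space set \<Rightarrow> ('a \<Rightarrow> real) set" where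
  "test_functions U = {\<psi>. (\<forall>k. Ck k \<psi>) \<and> compact (closure {x. \<psi> x \<noteq> 0})
     \<and> closure {x. \<psi> x \<noteq> 0} \<subseteq> U}"

text \<open>The integrand below is \<open>F \<bullet> \<nabla>\<psi>\<close>: the derivative of \<open>\<psi>\<close> at \<open>x\<close> is applied to \<open>F x\<close>.\<close>

definition divergence_free_on :: "'a::euclidean_space set \<Rightarrow> ('a \<Rightarrow> 'a) \<Rightarrow> bool" where
  "divergence_free_on U F \<longleftrightarrow>
     (\<forall>\<psi>\<in>test_functions U. (LINT x:U|lborel. frechet_derivative \<psi> (at x) (F x)) = 0)"


section \<open>Hausdorff measure\<close>

text \<open>The dimension is a natural number \<open>k\<close>, so that \<open>0 ^ 0 = 1\<close> makes the case \<open>k = 0\<close> the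
  counting measure; the empty set then has to be given the value \<open>0\<close> separately. The condition
  \<open>bounded (C i)\<close> is needed because \<open>diameter\<close> is meaningless on unbounded sets.\<close>

definition hausdorff_content :: "nat \<Rightarrow> real \<Rightarrow> 'a::euclidean_space set \<Rightarrow> ennreal" where
  "hausdorff_content k \<delta> A =
     (INF C\<in>{C :: nat \<Rightarrow> 'a set. A \<subseteq> (\<Union>i. C i) \<and> (\<forall>i. bounded (C i) \<and> diameter (C i) \<le> \<delta>)}.
        \<Sum>i. if C i = {} then 0 else ennreal (unit_ball_vol (real k) * (diameter (C i) / 2) ^ k))"

definition hausdorff_measure :: "nat \<Rightarrow> 'a::euclidean_space set \<Rightarrow> ennreal" where
  "hausdorff_measure k A = (SUP \<delta>\<in>{0<..}. hausdorff_content k \<delta> A)"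

definition hausdorff_ae :: "nat \<Rightarrow> 'a::euclidean_space set \<Rightarrow> ('a \<Rightarrow> bool) \<Rightarrow> bool" where
  "hausdorff_ae k A P \<longleftrightarrow> hausdorff_measure k {x\<in>A. \<not> P x} = 0"


section \<open>Hypersurfaces, boundaries and normals\<close>

text \<open>In a chart \<open>(U, e, f)\<close> the unit vector \<open>e\<close> is the vertical direction, and the function \<open>f\<close> is
  only evaluated on the hyperplane orthogonal to \<open>e\<close>.\<close>

definition hproj :: "'a::euclidean_space \<Rightarrow> 'a \<Rightarrow> 'a" where
  "hproj e y = y - (y \<bullet> e) *\<^sub>R e"

definition lipschitz_hypersurface :: "'a::euclidean_space set \<Rightarrow> bool" where
  "lipschitz_hypersurface S \<longleftrightarrow>
     (\<forall>z\<in>S. \<exists>U e f L. open U \<and> z \<in> U \<and> norm e = 1 \<and> L-lipschitz_on (hproj e ` U) f \<and>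
        S \<inter> U = {y\<in>U. y \<bullet> e = f (hproj e y)})"

definition lipschitz_boundary :: "'a::euclidean_space set \<Rightarrow> bool" where
  "lipschitz_boundary \<Omega> \<longleftrightarrow>
     (\<forall>x\<in>frontier \<Omega>. \<exists>U e f L. open U \<and> x \<in> U \<and> norm e = 1 \<and> L-lipschitz_on (hproj e ` U) f \<and>
        \<Omega> \<inter> U = {y\<in>U. y \<bullet> e < f (hproj e y)})"

definition C1_boundary :: "'a::euclidean_space set \<Rightarrow> bool" where
  "C1_boundary \<Omega> \<longleftrightarrow>
     (\<forall>x\<in>frontier \<Omega>. \<exists>U e f. open U \<and> x \<in> U \<and> norm e = 1 \<and> Ck 1 f \<and>
        \<Omega> \<inter> U = {y\<in>U. y \<bullet> e < f (hproj e y)})"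

text \<open>On a Lipschitz graph, \<open>v\<close> is a unit normal at \<open>z\<close> in the following sense iff the graph
  function is differentiable at the projection of \<open>z\<close> and \<open>v\<close> is one of the two unit vectors
  orthogonal to the tangent hyperplane.\<close>

definition unit_normal_at :: "'a::euclidean_space set \<Rightarrow> 'a \<Rightarrow> 'a \<Rightarrow> bool" where
  "unit_normal_at S z v \<longleftrightarrow> norm v = 1 \<and>
     (\<forall>\<epsilon>>0. \<exists>\<delta>>0. \<forall>y\<in>S. dist y z < \<delta> \<longrightarrow> \<bar>(y - z) \<bullet> v\<bar> \<le> \<epsilon> * dist y z)"

definition outward_unit_normal_at :: "'a::euclidean_space set \<Rightarrow> 'a \<Rightarrow> 'a \<Rightarrow> bool" where
  "outward_unit_normal_at \<Omega> x v \<longleftrightarrow> unit_normal_at (frontier \<Omega>) x v \<and>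
     (\<forall>\<^sub>F t in at_right (0::real). x + t *\<^sub>R v \<notin> \<Omega> \<and> x - t *\<^sub>R v \<in> \<Omega>)"


section \<open>Approximate regularity\<close>

definition density_zero_at :: "'a::euclidean_space set \<Rightarrow> 'a \<Rightarrow> bool" where
  "density_zero_at E z \<longleftrightarrow>
     ((\<lambda>r. measure lebesgue (E \<inter> ball z r) / measure lebesgue (ball z r)) \<longlongrightarrow> 0) (at_right 0)"

text \<open>The condition at \<open>z\<close> is invariant under \<open>v \<mapsto> - v\<close>, and the unit normal of a Lipschitz
  hypersurface is unique up to sign almost everywhere. Quantifying over all unit normals \<open>v\<close> at
  \<open>z\<close> is therefore the same as fixing a normal vector field.\<close>

definition approximately_regular_on :: "'a::euclidean_space set \<Rightarrow> ('a \<Rightarrow> 'a) \<Rightarrow> bool" where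
  "approximately_regular_on D \<phi> \<longleftrightarrow>
     (\<forall>S. lipschitz_hypersurface S \<longrightarrow>
        hausdorff_ae (DIM('a) - 1) (S \<inter> D) (\<lambda>z. \<forall>v. unit_normal_at S z v \<longrightarrow>
          (\<forall>\<epsilon>>0. density_zero_at {y\<in>D. \<bar>(\<phi> y - \<phi> z) \<bullet> v\<bar> > \<epsilon>} z)))"


section \<open>Jump points and special functions of bounded variation\<close>

definition half_ball :: "'a::euclidean_space \<Rightarrow> 'a \<Rightarrow> real \<Rightarrow> 'a set" where
  "half_ball x v r = {y \<in> ball x r. (y - x) \<bullet> v > 0}"

definition one_sided_approx_limit ::
    "('a::euclidean_space \<Rightarrow> real) \<Rightarrow> 'a \<Rightarrow> 'a \<Rightarrow> real \<Rightarrow> bool" where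
  "one_sided_approx_limit u x v a \<longleftrightarrow>
     ((\<lambda>r. (LINT y:half_ball x v r|lebesgue. \<bar>u y - a\<bar>) / measure lebesgue (half_ball x v r))
        \<longlongrightarrow> 0) (at_right 0)"

text \<open>\<open>jump_at u x a b v\<close> states that \<open>x\<close> is a jump point with \<open>u\<^sup>- = a\<close>, \<open>u\<^sup>+ = b\<close>, \<open>\<nu>\<^sub>u = v\<close>.
  The triple \<open>(a, b, v)\<close> is determined by \<open>u\<close> and \<open>x\<close>.\<close>

definition jump_at ::
    "('a::euclidean_space \<Rightarrow> real) \<Rightarrow> 'a \<Rightarrow> real \<Rightarrow> real \<Rightarrow> 'a \<Rightarrow> bool" where
  "jump_at u x a b v \<longleftrightarrow> a < b \<and> norm v = 1 \<and>
     one_sided_approx_limit u x v b \<and> one_sided_approx_limit u x (- v) a"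

definition jump_set :: "('a::euclidean_space \<Rightarrow> real) \<Rightarrow> 'a set" where
  "jump_set u = {x. \<exists>a b v. jump_at u x a b v}"

text \<open>\<open>u\<close> is in \<open>SBV\<close> with approximate gradient \<open>g\<close>: the distributional derivative of \<open>u\<close> is a
  finite vector measure whose absolutely continuous part has density \<open>g\<close> and whose singular part
  is concentrated on the jump set, i.e. there is no Cantor part. The finite vector measure that
  forms the singular part is written as \<open>\<sigma> \<mu>\<close>, a finite positive Borel measure \<open>\<mu>\<close> with an
  integrable vector-valued density \<open>\<sigma>\<close>. It is singular because \<open>jump_set u\<close> is Lebesgue negligible,
  so \<open>g\<close> is unique up to null sets.\<close>

definition SBV_with_gradient ::
    "('a::euclidean_space \<Rightarrow> real) \<Rightarrow> ('a \<Rightarrow> 'a) \<Rightarrow> bool" where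
  "SBV_with_gradient u g \<longleftrightarrow> integrable lebesgue u \<and> integrable lebesgue g \<and>
     (\<exists>\<mu> \<sigma> :: 'a \<Rightarrow> 'a. sets \<mu> = sets borel \<and> finite_measure \<mu> \<and> integrable \<mu> \<sigma> \<and>
        (AE x in \<mu>. x \<in> jump_set u) \<and>
        (\<forall>\<psi>\<in>test_functions UNIV. \<forall>e\<in>Basis.
           (LINT x|lebesgue. u x * frechet_derivative \<psi> (at x) e) =
             - (LINT x|lebesgue. \<psi> x * (g x \<bullet> e)) - (LINT x|\<mu>. \<psi> x * (\<sigma> x \<bullet> e))))"


section \<open>Calibrations\<close>

text \<open>\<open>\<phi>\<close> is a total function, but only its values on \<open>(- \<Omega>) \<times> {0..1}\<close> matter. The function \<open>g\<close> is
  the approximate gradient of \<open>u\<close>; being unique up to null sets, it may be quantified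
  existentially.\<close>

definition calibration :: "real \<Rightarrow> real \<Rightarrow> 'a::euclidean_space set \<Rightarrow> ('a \<Rightarrow> real) \<Rightarrow>
    ('a \<times> real \<Rightarrow> 'a \<times> real) \<Rightarrow> bool" where
  "calibration \<beta> \<gamma> \<Omega> u \<phi> \<longleftrightarrow>
     bounded \<Omega> \<and> open \<Omega> \<and> lipschitz_boundary \<Omega> \<and>
     compact (closure {x. u x \<noteq> 0}) \<and> (\<forall>x\<in>\<Omega>. u x = 1) \<and> (\<forall>x. 0 \<le> u x \<and> u x \<le> 1) \<and>
     \<phi> \<in> borel_measurable (restrict_space borel ((- \<Omega>) \<times> {0..1})) \<and>
     bounded (\<phi> ` ((- \<Omega>) \<times> {0..1})) \<and>
     approximately_regular_on ((- \<Omega>) \<times> {0..1}) \<phi> \<and>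
     divergence_free_on ((- closure \<Omega>) \<times> {0<..<1}) \<phi> \<and>
     (AE x in lebesgue. x \<notin> closure \<Omega> \<longrightarrow>
        (\<forall>t\<in>{0..1}. snd (\<phi> (x, t)) \<ge>
           1/4 * (norm (fst (\<phi> (x, t))))\<^sup>2 - \<gamma>\<^sup>2 * indicator {0<..} t)) \<and>
     hausdorff_ae (DIM('a) - 1) (- \<Omega>) (\<lambda>x. \<forall>r\<in>{0..1}. \<forall>s\<in>{0..1}.
        norm (LBINT t=ereal r..ereal s. fst (\<phi> (x, t))) \<le> \<beta> * (r\<^sup>2 + s\<^sup>2)) \<and>
     (\<exists>g. SBV_with_gradient u g \<and>
        (AE x in lebesgue. x \<notin> closure \<Omega> \<longrightarrow>
           fst (\<phi> (x, u x)) = 2 *\<^sub>R g x \<and>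
           snd (\<phi> (x, u x)) = (norm (g x))\<^sup>2 - \<gamma>\<^sup>2 * indicator {0<..} (u x))) \<and>
     hausdorff_ae (DIM('a) - 1) (jump_set u) (\<lambda>x. \<forall>a b v. jump_at u x a b v \<longrightarrow>
        (LBINT t=ereal a..ereal b. fst (\<phi> (x, t))) = (\<beta> * (a\<^sup>2 + b\<^sup>2)) *\<^sub>R v)"

end

theory Submission
  imports Defs
begin

text \<open>
  The calibration is the horizontal field \<open>\<phi>(x, t) = (- 2 \<beta> t \<nu>(x), 0)\<close>. Its integral over the heights
  from \<open>r\<close> to \<open>s\<close> is \<open>\<beta> (r\<^sup>2 - s\<^sup>2) \<nu>(x)\<close>, which gives (b) since \<open>\<bar>\<nu>\<bar> \<le> 1\<close>, and equals \<open>- \<beta> \<nu>(x)\<close> for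
  \<open>r = 0\<close> and \<open>s = 1\<close>, which gives (b') since \<open>1\<^sub>\<Omega>\<close> jumps from \<open>0\<close> to \<open>1\<close> in the direction \<open>- \<nu>\<close>.
  Condition (a) reads \<open>\<beta>\<^sup>2 t\<^sup>2 \<bar>\<nu>\<bar>\<^sup>2 \<le> \<gamma>\<^sup>2\<close> for \<open>t > 0\<close> and is the place where \<open>\<beta> \<le> \<gamma>\<close> enters; (a') holds
  because \<open>\<phi>\<close> vanishes at height \<open>0\<close>. The field is continuous, hence approximately regular, and it is
  divergence-free because \<open>\<nu>\<close> is (\<open>divergence_free_horizontal\<close>).

  The substance of the proof concerns the function \<open>1\<^sub>\<Omega>\<close> itself. Its jump set and its traces follow
  from the existence of the normal alone: outside thin cones around the tangent plane, \<open>\<Omega>\<close> fills one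
  side and its complement the other (\<open>normal_cones\<close>, \<open>jump_at_indicatorD\<close>).

  That \<open>1\<^sub>\<Omega>\<close> belongs to SBV, with vanishing approximate gradient, is the Gauss--Green formula
  (\<open>SBV_indicator_C1_domain\<close>). In a chart the domain is the region below the graph of a C1 function
  in some direction \<open>e\<close>. The integral of a directional derivative over this region is the rate of
  change of the integral under translation, and slicing along \<open>e\<close> reduces that to the chain rule in
  one variable (\<open>gauss_green_graph\<close>). Surface integrals are written as volume integrals over a slab
  of thickness one orthogonal to \<open>e\<close>; so the perimeter measure is an image of a measure with a
  Lebesgue density. The normal of the chart is the given field \<open>\<nu>\<close> (\<open>outward_normal_graph\<close>), and a
  partition of unity of class C1 combines the charts.
\<close>

section \<open>Traces at a boundary point with a normal\<close>

lemma measure_ball_cone: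
  fixes x :: "'a::euclidean_space"
  assumes cone: "\<And>y t. t > 0 \<Longrightarrow> P (t *\<^sub>R y) \<longleftrightarrow> P y" and "r > 0"
  shows "measure lebesgue {y \<in> ball x r. P (y - x)} =
    r ^ DIM('a) * measure lebesgue {y \<in> ball 0 1. P y}"
proof -
  have "{y \<in> ball x r. P (y - x)} = (\<lambda>y. r *\<^sub>R y + x) ` {y \<in> ball 0 1. P y}"
  proof (intro set_eqI iffI)
    fix y assume y: "y \<in> {y \<in> ball x r. P (y - x)}"
    define z where "z = (1 / r) *\<^sub>R (y - x)"
    have "y = r *\<^sub>R z + x" using \<open>r > 0\<close> by (simp add: z_def)
    moreover have "norm z < 1" using y \<open>r > 0\<close> by (simp add: z_def dist_norm norm_minus_commute)
    moreover have "P z" using y cone[of "1/r"] \<open>r > 0\<close> by (simp add: z_def)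
    ultimately show "y \<in> (\<lambda>y. r *\<^sub>R y + x) ` {y \<in> ball 0 1. P y}" by auto
  next
    fix y assume "y \<in> (\<lambda>y. r *\<^sub>R y + x) ` {y \<in> ball 0 1. P y}"
    then show "y \<in> {y \<in> ball x r. P (y - x)}"
      using cone \<open>r > 0\<close> by (auto simp: dist_norm)
  qed
  then show ?thesis
    using measure_lebesgue_affine[of r x "{y \<in> ball 0 1. P y}"] \<open>r > 0\<close> by simp
qed

lemma open_half_ball: "open (half_ball x v r)"
proof -
  have "half_ball x v r = ball x r \<inter> {y. (y - x) \<bullet> v > 0}" by (auto simp: half_ball_def)
  moreover have "open {y. (y - x) \<bullet> v > 0}"
    by (intro open_Collect_less continuous_intros)
  ultimately show ?thesis by auto
qed

lemma bounded_half_ball: "bounded (half_ball x v r)"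
  by (rule bounded_subset[OF bounded_ball[of x r]]) (auto simp: half_ball_def)

lemma half_ball_lmeasurable: "half_ball x v r \<in> lmeasurable"
  by (simp add: lmeasurable_open open_half_ball bounded_half_ball)

lemma half_ball_unit_nonempty:
  assumes "norm v = 1"
  shows "half_ball (0::'a::euclidean_space) v 1 \<noteq> {}"
proof -
  have "v \<bullet> v = 1" using assms by (simp add: norm_eq_1)
  then have "v /\<^sub>R 2 \<in> half_ball 0 v 1" using assms by (simp add: half_ball_def)
  then show ?thesis by blast
qed

lemma measure_half_ball:
  fixes x :: "'a::euclidean_space"
  shows "r > 0 \<Longrightarrow> measure lebesgue (half_ball x v r) = r ^ DIM('a) * measure lebesgue (half_ball 0 v 1)"
  unfolding half_ball_def
  using measure_ball_cone[of "\<lambda>y. y \<bullet> v > 0" r x] by (simp add: zero_less_mult_iff)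

lemma measure_open_pos:
  fixes S :: "'a::euclidean_space set"
  assumes "open S" "bounded S" "S \<noteq> {}"
  shows "measure lebesgue S > 0"
proof -
  have "S \<in> lmeasurable" using assms by (simp add: lmeasurable_open)
  moreover have "\<not> negligible S" using assms open_not_negligible by blast
  ultimately show ?thesis
    by (metis measure_nonneg negligible_iff_measure order_less_le)
qed

text \<open>Around the hyperplane orthogonal to a unit vector, double cones of small aperture carry
  little volume, since they shrink to the hyperplane.\<close>

lemma thin_cone_measure:
  fixes v :: "'a::euclidean_space"
  assumes "norm v = 1" "\<eta> > 0"
  obtains \<epsilon> where "\<epsilon> > 0" "\<epsilon> < 1" "measure lebesgue {y \<in> ball 0 1. \<bar>y \<bullet> v\<bar> \<le> \<epsilon> * norm y} < \<eta>"
proof -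
  \<comment> \<open>the shift by two keeps all apertures below \<open>1\<close>\<close>
  define c where "c n = 1 / real (Suc (Suc n))" for n
  have c: "c n > 0" "c n < 1" "c (Suc n) \<le> c n" for n
    by (auto simp: c_def intro!: frac_le)
  have c0: "c \<longlonglongrightarrow> 0"
    unfolding c_def using LIMSEQ_ignore_initial_segment[OF LIMSEQ_inverse_real_of_nat, of 1]
    by (simp add: inverse_eq_divide)
  define A where "A n = {y \<in> ball (0::'a) 1. \<bar>y \<bullet> v\<bar> \<le> c n * norm y}" for n
  have bor: "A n \<in> sets borel" for n
    unfolding A_def by measurable
  have lm: "A n \<in> lmeasurable" for n
  proof (rule bounded_set_imp_lmeasurable)
    show "bounded (A n)" by (rule bounded_subset[OF bounded_ball[of 0 1]]) (auto simp: A_def)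
    show "A n \<in> sets lebesgue" using bor by (simp add: sets_completionI_sets)
  qed
  have dec: "decseq A"
  proof (rule decseq_SucI, rule subsetI)
    fix n y assume "y \<in> A (Suc n)"
    then have y: "y \<in> ball 0 1" "\<bar>y \<bullet> v\<bar> \<le> c (Suc n) * norm y" by (auto simp: A_def)
    note y(2)
    also have "c (Suc n) * norm y \<le> c n * norm y" by (intro mult_right_mono c) simp
    finally show "y \<in> A n" using y(1) by (simp add: A_def)
  qed
  have sub: "(\<Inter>n. A n) \<subseteq> {y. v \<bullet> y = 0}"
  proof
    fix y assume "y \<in> (\<Inter>n. A n)"
    then have "\<bar>y \<bullet> v\<bar> \<le> c n * norm y" for n by (simp add: A_def)
    moreover have "(\<lambda>n. c n * norm y) \<longlonglongrightarrow> 0 * norm y" by (intro tendsto_intros c0)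
    ultimately have "\<bar>y \<bullet> v\<bar> \<le> 0 * norm y" by (intro LIMSEQ_le_const) blast+
    then show "y \<in> {y. v \<bullet> y = 0}" by (simp add: inner_commute)
  qed
  have "negligible {y. v \<bullet> y = 0}" using assms(1) by (intro negligible_hyperplane) auto
  then have "measure lebesgue (\<Inter>n. A n) = 0"
    using sub negligible_subset negligible_imp_measure0 by blast
  moreover have "(\<lambda>n. measure lebesgue (A n)) \<longlonglongrightarrow> measure lebesgue (\<Inter>n. A n)"
  proof (rule Lim_measure_decseq[OF _ dec])
    show "range A \<subseteq> sets lebesgue" using lm by (auto simp: fmeasurable_def)
    show "emeasure lebesgue (A n) \<noteq> \<infinity>" for n using lm[of n] unfolding fmeasurable_def by auto
  qed
  ultimately have "(\<lambda>n. measure lebesgue (A n)) \<longlonglongrightarrow> 0" by simp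
  from order_tendstoD(2)[OF this \<open>\<eta> > 0\<close>]
  obtain n where "measure lebesgue (A n) < \<eta>" by (auto simp: eventually_sequentially)
  then show ?thesis using that[OF c(1,2)[of n]] unfolding A_def by blast
qed

text \<open>A trace needs to be attained only outside arbitrarily thin cones around the tangent
  hyperplane: the rest of the half ball has a small proportion of the volume, at every radius.\<close>

lemma one_sided_approx_limitI:
  fixes u :: "'a::euclidean_space \<Rightarrow> real"
  assumes v: "norm v = 1" and u: "u \<in> borel_measurable borel" and le: "\<And>y. \<bar>u y - a\<bar> \<le> 1"
    and cone: "\<And>\<epsilon>. 0 < \<epsilon> \<Longrightarrow> \<epsilon> < 1 \<Longrightarrow>
      \<exists>\<delta>>0. \<forall>y\<in>ball x \<delta>. (y - x) \<bullet> v > \<epsilon> * norm (y - x) \<longrightarrow> u y = a"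
  shows "one_sided_approx_limit u x v a"
  unfolding one_sided_approx_limit_def
proof (rule tendstoI)
  fix e :: real assume "e > 0"
  define k where "k = measure lebesgue (half_ball (0::'a) v 1)"
  have k: "k > 0" unfolding k_def using v
    by (intro measure_open_pos open_half_ball bounded_half_ball half_ball_unit_nonempty)
  obtain \<epsilon> where \<epsilon>: "\<epsilon> > 0" "\<epsilon> < 1" "measure lebesgue {y \<in> ball (0::'a) 1. \<bar>y \<bullet> v\<bar> \<le> \<epsilon> * norm y} < e * k"
    using thin_cone_measure[OF v, of "e * k"] \<open>e > 0\<close> k by auto
  obtain \<delta> where \<delta>: "\<delta> > 0" "\<And>y. y \<in> ball x \<delta> \<Longrightarrow> (y - x) \<bullet> v > \<epsilon> * norm (y - x) \<Longrightarrow> u y = a"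
    using cone[OF \<epsilon>(1,2)] by blast
  have "dist ((LINT y:half_ball x v r|lebesgue. \<bar>u y - a\<bar>) / measure lebesgue (half_ball x v r)) 0 < e"
    if r: "0 < r" "r < \<delta>" for r
  proof -
    define T where "T = {y \<in> ball x r. \<bar>(y - x) \<bullet> v\<bar> \<le> \<epsilon> * norm (y - x)}"
    have T_bor: "T \<in> sets borel" unfolding T_def by measurable
    then have T_lm: "T \<in> lmeasurable"
      by (intro bounded_set_imp_lmeasurable bounded_subset[OF bounded_ball[of x r]])
        (auto simp: T_def intro: sets_completionI_sets)
    have "(LINT y:half_ball x v r|lebesgue. \<bar>u y - a\<bar>) \<le> (LINT y|lebesgue. indicator T y)"
      unfolding set_lebesgue_integral_def
    proof (rule integral_mono')
      show "integrable lebesgue (indicator T :: 'a \<Rightarrow> real)"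
        using T_lm by (intro integrable_real_indicator) (auto simp: fmeasurable_def)
      show "indicator (half_ball x v r) y *\<^sub>R \<bar>u y - a\<bar> \<le> indicator T y" for y
      proof (cases "y \<in> half_ball x v r \<and> u y \<noteq> a")
        case True
        then have "y \<in> ball x \<delta>" using r by (auto simp: half_ball_def)
        then have "\<not> (y - x) \<bullet> v > \<epsilon> * norm (y - x)" using \<delta>(2) True by blast
        then have "y \<in> T" using True by (auto simp: T_def half_ball_def)
        then show ?thesis using True le by simp
      qed (auto simp: indicator_def)
    qed (simp_all)
    also have "\<dots> = measure lebesgue T" using T_lm by simp
    also have "\<dots> = r ^ DIM('a) * measure lebesgue {y \<in> ball (0::'a) 1. \<bar>y \<bullet> v\<bar> \<le> \<epsilon> * norm y}"
      unfolding T_def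
      using measure_ball_cone[of "\<lambda>y. \<bar>y \<bullet> v\<bar> \<le> \<epsilon> * norm y" r x] r
      by (simp add: abs_mult mult.left_commute)
    also have "\<dots> < r ^ DIM('a) * (e * k)" using \<epsilon>(3) r by simp
    finally have "(LINT y:half_ball x v r|lebesgue. \<bar>u y - a\<bar>) < e * measure lebesgue (half_ball x v r)"
      using measure_half_ball[OF r(1), of x v] by (simp add: k_def mult_ac)
    moreover have "0 \<le> (LINT y:half_ball x v r|lebesgue. \<bar>u y - a\<bar>)"
      unfolding set_lebesgue_integral_def by (rule integral_nonneg_AE) simp
    moreover have "measure lebesgue (half_ball x v r) > 0"
      using measure_half_ball[OF r(1), of x v] k r by (simp add: k_def)
    ultimately show ?thesis by (simp add: divide_less_eq)
  qed
  then show "\<forall>\<^sub>F r in at_right 0. dist ((LINT y:half_ball x v r|lebesgue. \<bar>u y - a\<bar>) /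
      measure lebesgue (half_ball x v r)) 0 < e"
    using \<delta>(1) by (auto simp: eventually_at_right_field)
qed

text \<open>Two half balls with a common centre, unless they are opposite, share a fixed proportion of
  their volume. On the common part both traces are approached, so they agree.\<close>

lemma one_sided_approx_limit_unique:
  fixes u :: "'a::euclidean_space \<Rightarrow> real"
  assumes "norm v = 1" "norm w = 1" "v \<noteq> - w"
    and u: "u \<in> borel_measurable borel" "\<And>y. \<bar>u y\<bar> \<le> B"
    and lim: "one_sided_approx_limit u x v a" "one_sided_approx_limit u x w c"
  shows "a = c"
proof -
  define H where "H v = measure lebesgue (half_ball (0::'a) v 1)" for v
  define Q where "Q v a r = (LINT y:half_ball x v r|lebesgue. \<bar>u y - a\<bar>)" for v a r
  define k where "k = measure lebesgue (half_ball (0::'a) v 1 \<inter> half_ball 0 w 1)"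
  have vw: "v \<bullet> w > -1"
  proof -
    have "(norm (v + w))\<^sup>2 = 2 + 2 * (v \<bullet> w)"
      using assms(1,2) by (simp add: power2_norm_eq_inner inner_add inner_commute norm_eq_1)
    moreover have "v + w \<noteq> 0" using assms(3) by (metis eq_neg_iff_add_eq_0)
    ultimately show ?thesis by (smt (verit) zero_less_norm_iff zero_less_power2)
  qed
  have "norm (v + w) \<le> 2" using norm_triangle_ineq[of v w] assms by simp
  then have "(v + w) /\<^sub>R 4 \<in> half_ball 0 v 1" "(v + w) /\<^sub>R 4 \<in> half_ball 0 w 1"
    using vw dot_square_norm[of v] dot_square_norm[of w] assms(1,2)
    by (auto simp: half_ball_def inner_add inner_commute)
  then have k: "k > 0" unfolding k_def
    by (intro measure_open_pos open_Int open_half_ball bounded_Int) (auto simp: bounded_half_ball)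
  have int: "integrable lebesgue (\<lambda>y. indicator (half_ball x v r) y *\<^sub>R \<bar>u y - a\<bar>)" for v a r
  proof (rule Bochner_Integration.integrable_bound)
    show "integrable lebesgue (\<lambda>y. (B + \<bar>a\<bar>) * indicator (half_ball x v r) y)"
      using half_ball_lmeasurable[of x v r] unfolding fmeasurable_def
      by (intro integrable_mult_right integrable_real_indicator) blast+
    have "u \<in> borel_measurable lebesgue" using u(1) by (simp add: measurable_completion)
    then show "(\<lambda>y. indicator (half_ball x v r) y *\<^sub>R \<bar>u y - a\<bar>) \<in> borel_measurable lebesgue"
      using half_ball_lmeasurable[of x v r] by measurable
    show "AE y in lebesgue. norm (indicator (half_ball x v r) y *\<^sub>R \<bar>u y - a\<bar>)
       \<le> norm ((B + \<bar>a\<bar>) * indicator (half_ball x v r) y)"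
    proof (rule AE_I2)
      fix y show "norm (indicator (half_ball x v r) y *\<^sub>R \<bar>u y - a\<bar>)
       \<le> norm ((B + \<bar>a\<bar>) * indicator (half_ball x v r) y)"
        using u(2)[of y] by (auto simp: indicator_def)
    qed
  qed
  have main: "\<bar>a - c\<bar> * k \<le> H v * (Q v a r / measure lebesgue (half_ball x v r))
      + H w * (Q w c r / measure lebesgue (half_ball x w r))" if r: "r > 0" for r
  proof -
    have H: "H v > 0" if "norm v = 1" for v
      unfolding H_def using that
      by (intro measure_open_pos open_half_ball bounded_half_ball half_ball_unit_nonempty)
    have m: "measure lebesgue (half_ball x v r) = r ^ DIM('a) * H v" for v
      unfolding H_def by (rule measure_half_ball[OF r])
    have W: "half_ball x v r \<inter> half_ball x w r \<in> lmeasurable"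
      using half_ball_lmeasurable by blast
    have "measure lebesgue (half_ball x v r \<inter> half_ball x w r) = r ^ DIM('a) * k"
    proof -
      have "half_ball x v r \<inter> half_ball x w r = {y \<in> ball x r. (y - x) \<bullet> v > 0 \<and> (y - x) \<bullet> w > 0}"
        and "half_ball (0::'a) v 1 \<inter> half_ball 0 w 1 = {y \<in> ball 0 1. y \<bullet> v > 0 \<and> y \<bullet> w > 0}"
        by (auto simp: half_ball_def)
      then show ?thesis unfolding k_def
        using measure_ball_cone[of "\<lambda>y. y \<bullet> v > 0 \<and> y \<bullet> w > 0" r x] r
        by (simp add: zero_less_mult_iff)
    qed
    then have "\<bar>a - c\<bar> * (r ^ DIM('a) * k) =
        (LINT y|lebesgue. \<bar>a - c\<bar> * indicator (half_ball x v r \<inter> half_ball x w r) y)"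
      using W by simp
    also have "\<dots> \<le> (LINT y|lebesgue. indicator (half_ball x v r) y *\<^sub>R \<bar>u y - a\<bar>
        + indicator (half_ball x w r) y *\<^sub>R \<bar>u y - c\<bar>)"
    proof (rule integral_mono')
      show "integrable lebesgue (\<lambda>y. indicator (half_ball x v r) y *\<^sub>R \<bar>u y - a\<bar>
        + indicator (half_ball x w r) y *\<^sub>R \<bar>u y - c\<bar>)" using int by (intro Bochner_Integration.integrable_add)
    qed (auto simp: indicator_def)
    also have "\<dots> = Q v a r + Q w c r"
      unfolding Q_def set_lebesgue_integral_def using int by (intro Bochner_Integration.integral_add)
    finally have "\<bar>a - c\<bar> * k \<le> (Q v a r + Q w c r) / r ^ DIM('a)"
      using r by (simp add: field_simps)
    also have "\<dots> = H v * (Q v a r / measure lebesgue (half_ball x v r))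
      + H w * (Q w c r / measure lebesgue (half_ball x w r))"
      using H[OF assms(1)] H[OF assms(2)] r by (simp add: m field_simps)
    finally show ?thesis .
  qed
  have "((\<lambda>r. H v * (Q v a r / measure lebesgue (half_ball x v r))
      + H w * (Q w c r / measure lebesgue (half_ball x w r))) \<longlongrightarrow> H v * 0 + H w * 0) (at_right 0)"
    using lim unfolding one_sided_approx_limit_def Q_def by (intro tendsto_intros)
  then have "\<bar>a - c\<bar> * k \<le> H v * 0 + H w * 0"
    by (rule tendsto_lowerbound) (use main in \<open>auto intro: eventually_at_rightI[of 0 1]\<close>)
  then show ?thesis using k by (simp add: mult_le_0_iff)
qed

text \<open>Outside a thin cone around the tangent hyperplane there are no boundary points, and the two
  components of this region are convex. So each of them lies on one side of the boundary, and the
  normal line tells which.\<close>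

lemma normal_cones:
  fixes \<Omega> :: "'a::euclidean_space set"
  assumes out: "outward_unit_normal_at \<Omega> x v" and \<epsilon>: "0 < \<epsilon>" "\<epsilon> < 1"
  shows "\<exists>\<delta>>0. \<forall>y\<in>ball x \<delta>. ((y - x) \<bullet> v > \<epsilon> * norm (y - x) \<longrightarrow> y \<notin> \<Omega>) \<and>
    ((y - x) \<bullet> (- v) > \<epsilon> * norm (y - x) \<longrightarrow> y \<in> \<Omega>)"
proof -
  have v: "norm v = 1" using out by (simp add: outward_unit_normal_at_def unit_normal_at_def)
  obtain \<delta> where \<delta>: "\<delta> > 0" "\<And>y. y \<in> frontier \<Omega> \<Longrightarrow> dist y x < \<delta> \<Longrightarrow> \<bar>(y - x) \<bullet> v\<bar> \<le> \<epsilon> * dist y x"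
    using out \<epsilon>(1) unfolding outward_unit_normal_at_def unit_normal_at_def by blast
  obtain t where t: "t > 0" "t < \<delta>" "x + t *\<^sub>R v \<notin> \<Omega>" "x - t *\<^sub>R v \<in> \<Omega>"
  proof -
    obtain b where b: "b > 0" "\<And>t. 0 < t \<Longrightarrow> t < b \<Longrightarrow> x + t *\<^sub>R v \<notin> \<Omega> \<and> x - t *\<^sub>R v \<in> \<Omega>"
      using out unfolding outward_unit_normal_at_def eventually_at_right_field by auto
    show ?thesis using that[of "min b \<delta> / 2"] b \<delta>(1) by auto
  qed
  define P where "P w = {y \<in> ball x \<delta>. (y - x) \<bullet> w > \<epsilon> * norm (y - x)}" for w
  have conn: "connected (P w)" for w
  proof -
    have "convex {y. \<epsilon> * norm (y - x) - (y - x) \<bullet> w < 0}"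
    proof (rule convexI)
      fix a b :: 'a and p q :: real
      assume ab: "a \<in> {y. \<epsilon> * norm (y - x) - (y - x) \<bullet> w < 0}" "b \<in> {y. \<epsilon> * norm (y - x) - (y - x) \<bullet> w < 0}"
        and pq: "0 \<le> p" "0 \<le> q" "p + q = 1"
      have *: "p *\<^sub>R a + q *\<^sub>R b - x = p *\<^sub>R (a - x) + q *\<^sub>R (b - x)"
        using arg_cong[OF pq(3), of "\<lambda>c. c *\<^sub>R x"] by (simp add: algebra_simps)
      have "norm (p *\<^sub>R a + q *\<^sub>R b - x) \<le> p * norm (a - x) + q * norm (b - x)"
        unfolding * using pq by (intro norm_triangle_le) simp
      then have "\<epsilon> * norm (p *\<^sub>R a + q *\<^sub>R b - x) \<le> \<epsilon> * (p * norm (a - x) + q * norm (b - x))"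
        using \<epsilon> by simp
      also have "\<dots> = p * (\<epsilon> * norm (a - x)) + q * (\<epsilon> * norm (b - x))" by (simp add: algebra_simps)
      also have "\<dots> < p * ((a - x) \<bullet> w) + q * ((b - x) \<bullet> w)"
      proof (cases "p = 0")
        case True
        then show ?thesis using ab pq by simp
      next
        case False
        then have "p * (\<epsilon> * norm (a - x)) < p * ((a - x) \<bullet> w)"
          using ab pq by (intro mult_strict_left_mono) auto
        moreover have "q * (\<epsilon> * norm (b - x)) \<le> q * ((b - x) \<bullet> w)"
          using ab pq by (intro mult_left_mono) auto
        ultimately show ?thesis by simp
      qed
      also have "\<dots> = (p *\<^sub>R a + q *\<^sub>R b - x) \<bullet> w" unfolding * by (simp add: inner_add)
      finally show "p *\<^sub>R a + q *\<^sub>R b \<in> {y. \<epsilon> * norm (y - x) - (y - x) \<bullet> w < 0}" by simp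
    qed
    moreover have "P w = ball x \<delta> \<inter> {y. \<epsilon> * norm (y - x) - (y - x) \<bullet> w < 0}" by (auto simp: P_def)
    ultimately show ?thesis by (simp add: convex_Int convex_connected)
  qed
  have fr: "P w \<inter> frontier \<Omega> = {}" if "w = v \<or> w = - v" for w
  proof -
    have "y \<notin> P w" if y: "y \<in> frontier \<Omega>" for y
    proof
      assume "y \<in> P w"
      then have "norm (y - x) < \<delta>" "(y - x) \<bullet> w > \<epsilon> * norm (y - x)"
        by (auto simp: P_def dist_norm norm_minus_commute)
      moreover have "\<bar>(y - x) \<bullet> w\<bar> = \<bar>(y - x) \<bullet> v\<bar>" using \<open>w = v \<or> w = - v\<close> by auto
      ultimately show False using \<delta>(2)[OF y] by (simp add: dist_norm)
    qed
    then show ?thesis by blast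
  qed
  have "\<epsilon> * t < t" using \<epsilon> t by simp
  then have inP: "x + t *\<^sub>R v \<in> P v" "x - t *\<^sub>R v \<in> P (- v)"
    using t v dot_square_norm[of v] by (auto simp: P_def dist_norm)
  have "P v \<inter> \<Omega> = {}"
    using connected_Int_frontier[OF conn[of v], of \<Omega>] fr[of v] inP(1) t(3) by blast
  moreover have "P (- v) \<subseteq> \<Omega>"
    using connected_Int_frontier[OF conn[of "- v"], of \<Omega>] fr[of "- v"] inP(2) t(4) by blast
  ultimately show ?thesis using \<delta>(1) by (intro exI[of _ \<delta>]) (auto simp: P_def)
qed

lemma traces_at_normal:
  fixes \<Omega> :: "'a::euclidean_space set"
  assumes "open \<Omega>" and out: "outward_unit_normal_at \<Omega> x v"
  shows "one_sided_approx_limit (indicator \<Omega>) x v 0"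
    and "one_sided_approx_limit (indicator \<Omega>) x (- v) 1"
proof -
  have v: "norm v = 1" using out by (simp add: outward_unit_normal_at_def unit_normal_at_def)
  have m: "(indicator \<Omega> :: 'a \<Rightarrow> real) \<in> borel_measurable borel" using assms(1) by simp
  show "one_sided_approx_limit (indicator \<Omega>) x v 0"
  proof (rule one_sided_approx_limitI[OF v m])
    fix \<epsilon> :: real assume "0 < \<epsilon>" "\<epsilon> < 1"
    from normal_cones[OF out this]
    show "\<exists>\<delta>>0. \<forall>y\<in>ball x \<delta>. (y - x) \<bullet> v > \<epsilon> * norm (y - x) \<longrightarrow> (indicator \<Omega> y :: real) = 0"
      by (auto simp: indicator_def)
  qed (auto simp: indicator_def)
  show "one_sided_approx_limit (indicator \<Omega>) x (- v) 1"
  proof (rule one_sided_approx_limitI[OF _ m])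
    fix \<epsilon> :: real assume "0 < \<epsilon>" "\<epsilon> < 1"
    from normal_cones[OF out this]
    show "\<exists>\<delta>>0. \<forall>y\<in>ball x \<delta>. (y - x) \<bullet> (- v) > \<epsilon> * norm (y - x) \<longrightarrow> (indicator \<Omega> y :: real) = 1"
      by (metis indicator_simps(1))
  qed (auto simp: indicator_def v)
qed

lemma frontier_jump_set:
  fixes \<Omega> :: "'a::euclidean_space set"
  assumes "open \<Omega>" "outward_unit_normal_at \<Omega> x v"
  shows "x \<in> jump_set (indicator \<Omega>)"
proof -
  have "norm (- v) = 1" using assms(2) by (simp add: outward_unit_normal_at_def unit_normal_at_def)
  then have "jump_at (indicator \<Omega>) x 0 1 (- v)"
    using traces_at_normal[OF assms] by (simp add: jump_at_def)
  then show ?thesis by (auto simp: jump_set_def)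
qed

text \<open>Off the boundary \<open>1\<^sub>\<Omega>\<close> is locally constant, so the two traces would coincide there. At a boundary
  point, every half ball that is not opposite to the outer one shares its trace \<open>0\<close>, and every half
  ball that is not opposite to the inner one shares its trace \<open>1\<close>. Together with \<open>a < b\<close> this
  leaves only the inward normal.\<close>

lemma jump_at_indicatorD:
  fixes \<Omega> :: "'a::euclidean_space set"
  assumes "open \<Omega>" and out: "\<And>x. x \<in> frontier \<Omega> \<Longrightarrow> outward_unit_normal_at \<Omega> x (\<nu> x)"
    and jump: "jump_at (indicator \<Omega>) x a b v"
  shows "a = 0 \<and> b = 1 \<and> v = - \<nu> x"
proof -
  have v: "norm v = 1" "norm (- v) = 1" "a < b"
    and lb: "one_sided_approx_limit (indicator \<Omega>) x v b"
    and la: "one_sided_approx_limit (indicator \<Omega>) x (- v) a"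
    using jump by (auto simp: jump_at_def)
  have uniq: "p = q" if "norm w = 1" "norm w' = 1" "w \<noteq> - w'"
    "one_sided_approx_limit (indicator \<Omega>) x w p" "one_sided_approx_limit (indicator \<Omega>) x w' q"
    for w w' p q
    using that assms(1)
    by (intro one_sided_approx_limit_unique[of w w' "indicator \<Omega>" 1 x p q]) (auto simp: indicator_def)
  have ne: "w \<noteq> - w" if "norm w = 1" for w :: 'a using that
    by (metis eq_neg_iff_add_eq_0 norm_zero scaleR_2 scaleR_eq_0_iff zero_neq_numeral zero_neq_one)
  have fr: "x \<in> frontier \<Omega>"
  proof (rule ccontr)
    assume "x \<notin> frontier \<Omega>"
    then consider "x \<in> interior \<Omega>" | "x \<in> - closure \<Omega>" by (auto simp: frontier_def)
    then obtain c :: real and \<delta> where c: "c = 0 \<or> c = 1" "\<delta> > 0" "\<And>y. y \<in> ball x \<delta> \<Longrightarrow> indicator \<Omega> y = c"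
    proof cases
      case 1
      then obtain \<delta> where "\<delta> > 0" "ball x \<delta> \<subseteq> \<Omega>" by (auto simp: mem_interior)
      then show ?thesis using that[of 1 \<delta>] by (auto simp: subset_eq)
    next
      case 2
      then obtain \<delta> where "\<delta> > 0" "ball x \<delta> \<subseteq> - closure \<Omega>"
        by (meson open_contains_ball open_Compl closed_closure)
      then show ?thesis using that[of 0 \<delta>] closure_subset[of \<Omega>] by (fastforce simp: subset_eq)
    qed
    have const: "one_sided_approx_limit (indicator \<Omega>) x w c" if "norm w = 1" for w
      using c assms(1) by (intro one_sided_approx_limitI[OF that]) (auto simp: indicator_def)
    have "b = c" by (rule uniq[OF v(1) v(1) ne[OF v(1)] lb const[OF v(1)]])
    moreover have "a = c" by (rule uniq[OF v(2) v(2) ne[OF v(2)] la const[OF v(2)]])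
    ultimately show False using v(3) by simp
  qed
  note tr = traces_at_normal[OF assms(1) out[OF fr]]
  have n: "norm (\<nu> x) = 1" "norm (- \<nu> x) = 1"
    using out[OF fr] by (auto simp: outward_unit_normal_at_def unit_normal_at_def)
  have v\<nu>: "v = - \<nu> x"
  proof (rule ccontr)
    assume "v \<noteq> - \<nu> x"
    then have b: "b = 0" using uniq[OF v(1) n(1) _ lb tr(1)] by simp
    show False
    proof (cases "v = \<nu> x")
      case True
      then have "a = 1" using uniq[OF v(2) n(2) _ la tr(2)] ne[OF v(2)] by simp
      then show False using b v(3) by simp
    next
      case False
      then have "b = 1" using uniq[OF v(1) n(2) _ lb tr(2)] by simp
      then show False using b by simp
    qed
  qed
  have "b = 1" using uniq[OF v(1) n(2) _ lb tr(2)] ne[OF v(1)] v\<nu> by simp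
  moreover have "a = 0" using uniq[OF v(2) n(1) _ la tr(1)] ne[OF v(2)] v\<nu> by simp
  ultimately show ?thesis using v\<nu> by simp
qed

section \<open>Continuously differentiable functions\<close>

text \<open>\<open>Ck 1\<close> asks for continuity of the partial derivatives in the directions of the basis; the charts
  of a domain have directions of their own, so here every direction is included.\<close>

definition C1 :: "('a::euclidean_space \<Rightarrow> real) \<Rightarrow> bool" where
  "C1 h \<longleftrightarrow> (\<forall>x. h differentiable (at x)) \<and>
     (\<forall>w. continuous_on UNIV (\<lambda>x. frechet_derivative h (at x) w))"

abbreviation dir_deriv :: "('a::euclidean_space \<Rightarrow> real) \<Rightarrow> 'a \<Rightarrow> 'a \<Rightarrow> real" where
  "dir_deriv h x w \<equiv> frechet_derivative h (at x) w"

lemma C1I: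
  assumes "\<And>x. (h has_derivative D x) (at x)" "\<And>w. continuous_on UNIV (\<lambda>x. D x w)"
  shows "C1 h"
proof -
  have "frechet_derivative h (at x) = D x" for x using frechet_derivative_at[OF assms(1)] by simp
  then show ?thesis using assms by (auto simp: C1_def differentiable_def)
qed

lemma C1_has_derivative: "C1 h \<Longrightarrow> (h has_derivative dir_deriv h x) (at x)"
  by (simp add: C1_def frechet_derivative_works[symmetric])

lemma C1_continuous_deriv: "C1 h \<Longrightarrow> continuous_on UNIV (\<lambda>x. dir_deriv h x w)"
  by (simp add: C1_def)

lemma C1_continuous: "C1 h \<Longrightarrow> continuous_on UNIV h"
  by (meson C1_def continuous_at_imp_continuous_on differentiable_imp_continuous_within)

lemma C1_linear_deriv: "C1 h \<Longrightarrow> linear (dir_deriv h x)"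
  using C1_has_derivative has_derivative_linear by blast

lemma dir_deriv_Basis_sum:
  assumes "h differentiable (at x)"
  shows "dir_deriv h x w = (\<Sum>b\<in>Basis. (w \<bullet> b) * dir_deriv h x b)"
proof -
  have "linear (frechet_derivative h (at x))" using assms by (rule linear_frechet_derivative)
  then have "frechet_derivative h (at x) (\<Sum>b\<in>Basis. (w \<bullet> b) *\<^sub>R b) = (\<Sum>b\<in>Basis. (w \<bullet> b) *\<^sub>R dir_deriv h x b)"
    by (simp add: linear_sum linear_cmul)
  then show ?thesis by (simp add: euclidean_representation)
qed

lemma C1_if_Ck_1:
  assumes "Ck 1 h"
  shows "C1 h"
proof -
  have d: "h differentiable (at x)" and c: "b \<in> Basis \<Longrightarrow> continuous_on UNIV (\<lambda>x. dir_deriv h x b)" for x b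
    using assms by (auto simp: One_nat_def)
  have "continuous_on UNIV (\<lambda>x. \<Sum>b\<in>Basis. (w \<bullet> b) * dir_deriv h x b)" for w
    by (intro continuous_intros c)
  then show ?thesis unfolding C1_def using d by (simp add: dir_deriv_Basis_sum[OF d, symmetric])
qed

lemma C1_mult: "C1 f \<Longrightarrow> C1 g \<Longrightarrow> C1 (\<lambda>x. f x * g x)"
  by (rule C1I[OF has_derivative_mult[OF C1_has_derivative C1_has_derivative]])
    (auto intro!: continuous_on_add continuous_on_mult simp: C1_continuous C1_continuous_deriv)

lemma C1_add: "C1 f \<Longrightarrow> C1 g \<Longrightarrow> C1 (\<lambda>x. f x + g x)"
  by (rule C1I[OF has_derivative_add[OF C1_has_derivative C1_has_derivative]])
    (auto intro!: continuous_on_add simp: C1_continuous_deriv)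

lemma C1_const: "C1 (\<lambda>x. c)"
  by (rule C1I[OF has_derivative_const]) (auto intro!: continuous_intros)

lemma C1_sum: "(\<And>i. i \<in> I \<Longrightarrow> C1 (f i)) \<Longrightarrow> C1 (\<lambda>x. \<Sum>i\<in>I. f i x)"
  by (induction I rule: infinite_finite_induct) (auto intro: C1_const C1_add)

lemma C1_compose_real:
  fixes g :: "real \<Rightarrow> real"
  assumes "C1 f" "\<And>x. (g has_real_derivative g' x) (at x)" "continuous_on UNIV g'"
  shows "C1 (\<lambda>x. g (f x))"
proof (rule C1I)
  show "((\<lambda>x. g (f x)) has_derivative (\<lambda>w. g' (f x) * dir_deriv f x w)) (at x)" for x
    using has_derivative_compose[OF C1_has_derivative[OF assms(1)]
        assms(2)[unfolded has_field_derivative_def]] by simp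
  have "continuous_on UNIV (\<lambda>x. g' (f x))"
    using continuous_on_compose2[OF assms(3) C1_continuous[OF assms(1)]] by simp
  then show "continuous_on UNIV (\<lambda>x. g' (f x) * dir_deriv f x w)" for w
    by (intro continuous_intros C1_continuous_deriv assms(1))
qed

lemma C1_inverse:
  assumes "C1 f" "\<And>x. f x \<noteq> 0"
  shows "C1 (\<lambda>x. inverse (f x))"
proof (rule C1I)
  show "((\<lambda>x. inverse (f x)) has_derivative (\<lambda>w. - (inverse (f x) * dir_deriv f x w * inverse (f x)))) (at x)" for x
    using Deriv.has_derivative_inverse[OF assms(2) C1_has_derivative[OF assms(1)]] .
  show "continuous_on UNIV (\<lambda>x. - (inverse (f x) * dir_deriv f x w * inverse (f x)))" for w
    using assms by (auto intro!: continuous_on_minus continuous_on_mult continuous_on_inverse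
      simp: C1_continuous C1_continuous_deriv)
qed

text \<open>Squaring removes the corner of the positive part. All cut-off functions below are built from this
  truncation; they are of class C1, like the functions to which the Gauss--Green formula is applied.\<close>

lemma has_real_derivative_pos_part_square:
  "((\<lambda>t::real. (max 0 t)\<^sup>2) has_real_derivative 2 * max 0 t) (at t)"
proof (cases "t = 0")
  case False
  then consider "t > 0" | "t < 0" by linarith
  then show ?thesis
  proof cases
    case 1
    have "((\<lambda>t::real. t\<^sup>2) has_real_derivative 2 * t) (at t)" by (auto intro!: derivative_eq_intros)
    then have "((\<lambda>t::real. (max 0 t)\<^sup>2) has_real_derivative 2 * t) (at t)"
      by (rule DERIV_cong_ev[THEN iffD1, rotated 3])
        (use 1 in \<open>auto intro!: eventually_mono[OF eventually_gt_at_top] eventually_nhds_in_open[of "{0<..}", THEN eventually_mono]\<close>)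
    then show ?thesis using 1 by simp
  next
    case 2
    have "((\<lambda>t::real. 0) has_real_derivative 0) (at t)" by simp
    then have "((\<lambda>t::real. (max 0 t)\<^sup>2) has_real_derivative 0) (at t)"
      by (rule DERIV_cong_ev[THEN iffD1, rotated 3])
        (use 2 in \<open>auto intro!: eventually_nhds_in_open[of "{..<0}", THEN eventually_mono]\<close>)
    then show ?thesis using 2 by simp
  qed
next
  case True
  have "((\<lambda>h. max 0 h) \<longlongrightarrow> max 0 0) (at (0::real))" by (intro tendsto_intros)
  moreover have "max 0 h = (max 0 h)\<^sup>2 / h" if "h \<noteq> 0" for h :: real
    using that by (auto simp: max_def power2_eq_square)
  ultimately have "((\<lambda>h. (max 0 h)\<^sup>2 / h) \<longlongrightarrow> 0) (at (0::real))"
    by (smt (verit) Lim_cong_within max.idem)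
  then show ?thesis using True by (simp add: DERIV_def)
qed

lemma C1_pos_part_square: "C1 f \<Longrightarrow> C1 (\<lambda>x. (max 0 (f x))\<^sup>2)"
  by (rule C1_compose_real[OF _ has_real_derivative_pos_part_square]) (auto intro!: continuous_intros)

lemma C1_const_minus: "C1 f \<Longrightarrow> C1 (\<lambda>x. c - f x)"
  using C1_add[OF C1_const[of c] C1_mult[OF C1_const[of "-1"]]] by simp

lemma C1_norm_square: "C1 (\<lambda>y. (norm (y - x))\<^sup>2)"
proof -
  have "((\<lambda>y. (y - x) \<bullet> (y - x)) has_derivative (\<lambda>w. (z - x) \<bullet> w + w \<bullet> (z - x))) (at z)" for z
    by (auto intro!: derivative_eq_intros)
  then have "C1 (\<lambda>y. (y - x) \<bullet> (y - x))"
    by (rule C1I) (auto intro!: continuous_intros)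
  then show ?thesis by (simp add: power2_norm_eq_inner)
qed

lemma C1_line_derivative:
  assumes "C1 h"
  shows "((\<lambda>s. h (y + s *\<^sub>R w)) has_real_derivative dir_deriv h (y + s *\<^sub>R w) w) (at s)"
proof -
  have "((\<lambda>s. y + s *\<^sub>R w) has_derivative (\<lambda>s. s *\<^sub>R w)) (at s)"
    by (auto intro!: derivative_eq_intros)
  from has_derivative_compose[OF this C1_has_derivative[OF assms]]
  show ?thesis
    by (simp add: has_field_derivative_def linear_cmul[OF C1_linear_deriv[OF assms]] mult_commute_abs)
qed

text \<open>This supplies the integrable bounds under which difference quotients converge.\<close>

lemma C1_line_lipschitz:
  assumes "C1 h" "compact K"
  obtains M where "M \<ge> 0" "\<And>y s. (\<And>r. 0 \<le> r \<Longrightarrow> r \<le> s \<Longrightarrow> y + r *\<^sub>R w \<in> K) \<Longrightarrow> 0 \<le> s \<Longrightarrow>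
    \<bar>h (y + s *\<^sub>R w) - h y\<bar> \<le> M * s"
proof -
  have "bounded ((\<lambda>x. dir_deriv h x w) ` K)"
    using continuous_on_subset[OF C1_continuous_deriv[OF assms(1)]] assms(2)
    by (intro compact_imp_bounded compact_continuous_image) auto
  then obtain M where M: "\<And>x. x \<in> K \<Longrightarrow> \<bar>dir_deriv h x w\<bar> \<le> M" "M > 0"
    by (auto simp: bounded_pos)
  show ?thesis
  proof (rule that[of M])
    fix y s assume in_K: "\<And>r. 0 \<le> r \<Longrightarrow> r \<le> s \<Longrightarrow> y + r *\<^sub>R w \<in> K" and "0 \<le> s"
    show "\<bar>h (y + s *\<^sub>R w) - h y\<bar> \<le> M * s"
    proof (cases "s = 0")
      case False
      then obtain r where r: "0 < r" "r < s"
        "h (y + s *\<^sub>R w) - h (y + 0 *\<^sub>R w) = (s - 0) * dir_deriv h (y + r *\<^sub>R w) w"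
        using MVT2[of 0 s "\<lambda>s. h (y + s *\<^sub>R w)", OF _ C1_line_derivative[OF assms(1)]] \<open>0 \<le> s\<close> by auto
      then have "\<bar>h (y + s *\<^sub>R w) - h y\<bar> = s * \<bar>dir_deriv h (y + r *\<^sub>R w) w\<bar>"
        using \<open>0 \<le> s\<close> by (simp add: abs_mult)
      also have "\<dots> \<le> s * M" using M(1)[OF in_K[of r]] r \<open>0 \<le> s\<close> by (intro mult_left_mono) auto
      finally show ?thesis by (simp add: mult.commute)
    qed simp
  qed (use M in simp)
qed

lemma dir_deriv_zero_outside:
  assumes "\<And>y. y \<in> U \<Longrightarrow> h y = 0" "open U" "x \<in> U"
  shows "dir_deriv h x w = 0"
proof -
  have "(h has_derivative (\<lambda>_. 0)) (at x)"
    by (rule has_derivative_transform_within_open[OF has_derivative_const[of 0] assms(2,3)])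
      (simp add: assms(1))
  then show ?thesis by (metis frechet_derivative_at)
qed

section \<open>Integration along lines of a fixed direction\<close>

abbreviation slab :: "'a::euclidean_space \<Rightarrow> 'a set" where
  "slab e \<equiv> {y. 0 \<le> y \<bullet> e \<and> y \<bullet> e < 1}"

lemma hproj_inner: "norm e = 1 \<Longrightarrow> hproj e y \<bullet> e = 0"
  by (simp add: hproj_def inner_diff_left norm_eq_1)

lemma continuous_on_hproj [continuous_intros]:
  "continuous_on S f \<Longrightarrow> continuous_on S (\<lambda>x. hproj e (f x))"
  unfolding hproj_def by (intro continuous_intros)

lemma measurable_hproj [measurable]: "hproj e \<in> borel_measurable borel"
  by (intro borel_measurable_continuous_onI continuous_intros)

lemma hproj_add_scale: "norm e = 1 \<Longrightarrow> hproj e (y + t *\<^sub>R e) = hproj e y"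
  by (simp add: hproj_def inner_add_left norm_eq_1 algebra_simps)

lemma slab_measurable [measurable]: "slab e \<in> sets borel"
  by measurable

lemma nn_integral_translate:
  fixes f :: "'a::euclidean_space \<Rightarrow> ennreal"
  assumes [measurable]: "f \<in> borel_measurable borel"
  shows "(\<integral>\<^sup>+y. f (y + c) \<partial>lborel) = (\<integral>\<^sup>+y. f y \<partial>lborel)"
proof -
  have "(\<integral>\<^sup>+y. f y \<partial>lborel) = (\<integral>\<^sup>+y. f y \<partial>distr lborel borel ((+) c))"
    by (simp add: lborel_distr_plus)
  also have "\<dots> = (\<integral>\<^sup>+y. f (c + y) \<partial>lborel)" by (subst nn_integral_distr) auto
  finally show ?thesis by (simp add: add.commute)
qed

lemma integral_translate:
  fixes f :: "'a::euclidean_space \<Rightarrow> real"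
  assumes [measurable]: "f \<in> borel_measurable borel"
  shows "(\<integral>y. f (y + c) \<partial>lborel) = (\<integral>y. f y \<partial>lborel)"
proof -
  have "(\<integral>y. f y \<partial>lborel) = (\<integral>y. f y \<partial>distr lborel borel ((+) c))"
    by (simp add: lborel_distr_plus)
  also have "\<dots> = (\<integral>y. f (c + y) \<partial>lborel)" by (subst integral_distr) auto
  finally show ?thesis by (simp add: add.commute)
qed

text \<open>Lebesgue measure is recovered from lines parallel to \<open>e\<close> without splitting off coordinates: the
  base points run through a slab of thickness one and are projected to the hyperplane orthogonal to
  \<open>e\<close>. Translation invariance alone proves it, first along each line and then, after exchanging the
  integrals, in the whole space; what remains is that a line meets the slab in length one.\<close>

lemma slab_slices_measure:
  fixes e :: "'a::euclidean_space"
  assumes e: "norm e = 1"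
  shows "distr (density (lborel \<Otimes>\<^sub>M lborel) (\<lambda>(y, t). indicator (slab e) y)) borel
    (\<lambda>(y, t). hproj e y + t *\<^sub>R e) = (lborel :: 'a measure)"
proof (rule measure_eqI)
  fix A assume "A \<in> sets (distr (density (lborel \<Otimes>\<^sub>M lborel) (\<lambda>(y, t). indicator (slab e) y)) borel
    (\<lambda>(y, t). hproj e y + t *\<^sub>R e))"
  then have A[measurable]: "A \<in> sets borel" by simp
  have ee: "e \<bullet> e = 1" using e by (simp add: norm_eq_1)
  have "emeasure (distr (density (lborel \<Otimes>\<^sub>M lborel) (\<lambda>(y, t). indicator (slab e) y)) borel
      (\<lambda>(y, t). hproj e y + t *\<^sub>R e)) A =
    (\<integral>\<^sup>+z. indicator A z \<partial>distr (density (lborel \<Otimes>\<^sub>M lborel) (\<lambda>(y, t). indicator (slab e) y)) borel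
      (\<lambda>(y, t). hproj e y + t *\<^sub>R e))" by simp
  also have "\<dots> = (\<integral>\<^sup>+z. (case z of (y, t) \<Rightarrow> indicator (slab e) y * indicator A (hproj e y + t *\<^sub>R e))
      \<partial>(lborel \<Otimes>\<^sub>M lborel))"
    by (subst nn_integral_distr, measurable, subst nn_integral_density)
      (auto intro!: nn_integral_cong simp: split_beta)
  also have "\<dots> = (\<integral>\<^sup>+y. \<integral>\<^sup>+t. indicator (slab e) y * indicator A (hproj e y + t *\<^sub>R e) \<partial>lborel \<partial>lborel)"
    by (subst lborel.nn_integral_fst[symmetric]) (auto simp: split_beta)
  also have "\<dots> = (\<integral>\<^sup>+y. \<integral>\<^sup>+t. indicator (slab e) y * indicator A (y + t *\<^sub>R e) \<partial>lborel \<partial>lborel)"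
  proof (rule nn_integral_cong)
    fix y :: 'a
    have "(\<integral>\<^sup>+t. indicator (slab e) y * indicator A (hproj e y + t *\<^sub>R e) \<partial>lborel) =
      (\<integral>\<^sup>+t. indicator (slab e) y * indicator A (hproj e y + (t + y \<bullet> e) *\<^sub>R e) \<partial>lborel)"
      by (rule nn_integral_translate[symmetric]) measurable
    then show "(\<integral>\<^sup>+t. indicator (slab e) y * indicator A (hproj e y + t *\<^sub>R e) \<partial>lborel) =
      (\<integral>\<^sup>+t. indicator (slab e) y * indicator A (y + t *\<^sub>R e) \<partial>lborel)"
      by (simp add: hproj_def algebra_simps)
  qed
  also have "\<dots> = (\<integral>\<^sup>+t. \<integral>\<^sup>+y. indicator (slab e) y * indicator A (y + t *\<^sub>R e) \<partial>lborel \<partial>lborel)"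
    by (rule lborel_pair.Fubini') measurable
  also have "\<dots> = (\<integral>\<^sup>+t. \<integral>\<^sup>+y. indicator (slab e) (y - t *\<^sub>R e) * indicator A y \<partial>lborel \<partial>lborel)"
  proof (rule nn_integral_cong)
    fix t :: real
    have "(\<integral>\<^sup>+y. indicator (slab e) ((y + t *\<^sub>R e) - t *\<^sub>R e) * indicator A (y + t *\<^sub>R e) \<partial>lborel) =
      (\<integral>\<^sup>+y. indicator (slab e) (y - t *\<^sub>R e) * indicator A y \<partial>lborel)"
      by (rule nn_integral_translate) measurable
    then show "(\<integral>\<^sup>+y. indicator (slab e) y * indicator A (y + t *\<^sub>R e) \<partial>lborel) =
      (\<integral>\<^sup>+y. indicator (slab e) (y - t *\<^sub>R e) * indicator A y \<partial>lborel)" by simp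
  qed
  also have "\<dots> = (\<integral>\<^sup>+y. \<integral>\<^sup>+t. indicator (slab e) (y - t *\<^sub>R e) * indicator A y \<partial>lborel \<partial>lborel)"
    by (rule lborel_pair.Fubini') measurable
  also have "\<dots> = (\<integral>\<^sup>+y. indicator A y \<partial>lborel)"
  proof (rule nn_integral_cong)
    fix y :: 'a
    have "(\<integral>\<^sup>+t. indicator (slab e) (y - t *\<^sub>R e) * indicator A y \<partial>lborel) =
      (\<integral>\<^sup>+t. indicator {y \<bullet> e - 1<..y \<bullet> e} t * indicator A y \<partial>lborel)"
      by (intro nn_integral_cong) (auto simp: inner_diff_left ee split: split_indicator)
    also have "\<dots> = (\<integral>\<^sup>+t. indicator {y \<bullet> e - 1<..y \<bullet> e} t \<partial>lborel) * indicator A y"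
      by (rule nn_integral_multc) measurable
    also have "\<dots> = indicator A y" by simp
    finally show "(\<integral>\<^sup>+t. indicator (slab e) (y - t *\<^sub>R e) * indicator A y \<partial>lborel) = indicator A y" .
  qed
  finally show "emeasure (distr (density (lborel \<Otimes>\<^sub>M lborel) (\<lambda>(y, t). indicator (slab e) y)) borel
      (\<lambda>(y, t). hproj e y + t *\<^sub>R e)) A = emeasure lborel A" by simp
qed simp

text \<open>The slab stands for the hyperplane orthogonal to \<open>e\<close>: the inner integral depends on \<open>y\<close> only through
  its projection. So integrals over hypersurfaces that are graphs in direction \<open>e\<close> can be written as
  volume integrals over the slab.\<close>

lemma integral_slices:
  fixes F :: "'a::euclidean_space \<Rightarrow> real"
  assumes e: "norm e = 1" and F: "integrable lborel F"
  shows "integrable lborel (\<lambda>y. indicator (slab e) y * (\<integral>t. F (hproj e y + t *\<^sub>R e) \<partial>lborel))"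
    and "(\<integral>y. F y \<partial>lborel) = (\<integral>y. indicator (slab e) y * (\<integral>t. F (hproj e y + t *\<^sub>R e) \<partial>lborel) \<partial>lborel)"
proof -
  define M where "M = density (lborel \<Otimes>\<^sub>M lborel) (\<lambda>(y, t::real). ennreal (indicator (slab e) (y::'a)))"
  define \<Phi> where "\<Phi> = (\<lambda>(y, t::real). hproj e y + t *\<^sub>R e)"
  have M_eq: "M = density (lborel \<Otimes>\<^sub>M lborel) (\<lambda>(y, t). indicator (slab e) y)"
    unfolding M_def by (rule arg_cong[where f = "density _"]) (auto simp: indicator_def)
  have d: "distr M borel \<Phi> = lborel"
    unfolding M_eq \<Phi>_def by (rule slab_slices_measure[OF e])
  have [measurable]: "F \<in> borel_measurable borel" using F by simp
  have [measurable]: "\<Phi> \<in> M \<rightarrow>\<^sub>M borel" unfolding \<Phi>_def M_def by measurable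
  have [measurable]: "(\<lambda>z. F (\<Phi> z)) \<in> borel_measurable (lborel \<Otimes>\<^sub>M lborel)" unfolding \<Phi>_def by measurable
  have dens: "M = density (lborel \<Otimes>\<^sub>M lborel) (\<lambda>z. ennreal (indicator (slab e) (fst z)))"
    unfolding M_def by (simp add: case_prod_unfold)
  have int: "integrable M (\<lambda>z. F (\<Phi> z))"
    using F integrable_distr_eq[of \<Phi> M borel F] by (simp add: d)
  then have int': "integrable (lborel \<Otimes>\<^sub>M lborel) (\<lambda>(y, t). indicator (slab e) y * F (hproj e y + t *\<^sub>R e))"
    unfolding dens by (subst (asm) integrable_density) (auto simp: \<Phi>_def case_prod_unfold)
  have "(\<integral>y. F y \<partial>lborel) = (\<integral>z. F (\<Phi> z) \<partial>M)"
    using integral_distr[of \<Phi> M borel F] by (simp add: d)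
  also have "\<dots> = (\<integral>(y, t). indicator (slab e) y * F (hproj e y + t *\<^sub>R e) \<partial>(lborel \<Otimes>\<^sub>M lborel))"
    unfolding dens by (subst integral_density) (auto simp: \<Phi>_def case_prod_unfold)
  also have "\<dots> = (\<integral>y. \<integral>t. indicator (slab e) y * F (hproj e y + t *\<^sub>R e) \<partial>lborel \<partial>lborel)"
    by (rule lborel_pair.integral_fst[OF int', symmetric])
  finally show "(\<integral>y. F y \<partial>lborel) = (\<integral>y. indicator (slab e) y * (\<integral>t. F (hproj e y + t *\<^sub>R e) \<partial>lborel) \<partial>lborel)"
    by simp
  show "integrable lborel (\<lambda>y. indicator (slab e) y * (\<integral>t. F (hproj e y + t *\<^sub>R e) \<partial>lborel))"
    using lborel_pair.integrable_fst[OF int'] by simp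
qed

section \<open>The Gauss--Green formula below a graph\<close>

lemma difference_quotient_LIMSEQ:
  fixes \<phi> :: "real \<Rightarrow> real"
  assumes "(\<phi> has_real_derivative d) (at 0)"
  shows "(\<lambda>n. (\<phi> (inverse (real (Suc n))) - \<phi> 0) / inverse (real (Suc n))) \<longlonglongrightarrow> d"
proof -
  have "((\<lambda>s. (\<phi> s - \<phi> 0) / s) \<longlongrightarrow> d) (at 0)" using assms by (simp add: DERIV_def)
  moreover have "filterlim (\<lambda>n. inverse (real (Suc n))) (at 0) sequentially"
    using LIMSEQ_inverse_real_of_nat by (intro filterlim_atI) auto
  ultimately show ?thesis by (rule filterlim_compose)
qed

lemma C1_compact_support_integrable:
  fixes h :: "'a::euclidean_space \<Rightarrow> real"
  assumes h: "continuous_on UNIV h" and supp: "\<And>y. norm y \<ge> R \<Longrightarrow> h y = 0"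
    and g: "g \<in> borel_measurable borel" "\<And>y. \<bar>g y\<bar> \<le> 1"
  shows "integrable lborel (\<lambda>y. g y * h y)"
proof (rule Bochner_Integration.integrable_bound)
  show "integrable lborel (\<lambda>y. indicator (cball 0 R) y *\<^sub>R h y)"
    by (rule borel_integrable_compact[OF compact_cball continuous_on_subset[OF h]]) simp
  have [measurable]: "h \<in> borel_measurable borel" using h by (rule borel_measurable_continuous_onI)
  show "(\<lambda>y. g y * h y) \<in> borel_measurable lborel" using g(1) by measurable
  have "\<bar>g y * h y\<bar> \<le> \<bar>indicator (cball 0 R) y *\<^sub>R h y\<bar>" for y
    using supp[of y] mult_right_mono[OF g(2)[of y], of "\<bar>h y\<bar>"] by (auto simp: indicator_def abs_mult)
  then show "AE y in lborel. norm (g y * h y) \<le> norm (indicator (cball 0 R) y *\<^sub>R h y)" by simp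
qed

text \<open>The integral over \<open>G\<close> of a directional derivative is the rate of change of the integral when the
  integrand is translated. This turns statements on derivatives into statements on translates of
  \<open>G\<close>.\<close>

lemma tendsto_integral_difference_quotient:
  fixes h :: "'a::euclidean_space \<Rightarrow> real"
  assumes h: "C1 h" and supp: "\<And>y. norm y \<ge> R \<Longrightarrow> h y = 0" and G: "G \<in> sets borel"
  shows "(\<lambda>n. ((\<integral>y. indicator G y * h (y + inverse (real (Suc n)) *\<^sub>R w) \<partial>lborel)
      - (\<integral>y. indicator G y * h y \<partial>lborel)) / inverse (real (Suc n)))
    \<longlonglongrightarrow> (\<integral>y. indicator G y * dir_deriv h y w \<partial>lborel)"
proof -
  define s where "s n = inverse (real (Suc n))" for n
  have s: "0 < s n" "s n \<le> 1" for n by (auto simp: s_def inverse_le_1_iff)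
  obtain M where M: "M \<ge> 0" "\<And>y s. (\<And>r. 0 \<le> r \<Longrightarrow> r \<le> s \<Longrightarrow> y + r *\<^sub>R w \<in> cball 0 (R + 2 * norm w)) \<Longrightarrow>
      0 \<le> s \<Longrightarrow> \<bar>h (y + s *\<^sub>R w) - h y\<bar> \<le> M * s"
    using C1_line_lipschitz[OF h compact_cball] by metis
  have cont: "continuous_on UNIV (\<lambda>y. h (y + c))" for c :: 'a
    by (rule continuous_on_compose2[OF C1_continuous[OF h]]) (auto intro!: continuous_intros)
  have [measurable]: "(\<lambda>y. h (y + c)) \<in> borel_measurable borel" "h \<in> borel_measurable borel"
    "(\<lambda>y. dir_deriv h y w) \<in> borel_measurable borel" for c :: 'a
    using cont C1_continuous[OF h] C1_continuous_deriv[OF h]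
    by (auto intro: borel_measurable_continuous_onI)
  have ind: "(indicator G :: 'a \<Rightarrow> real) \<in> borel_measurable borel" "\<bar>indicator G y :: real\<bar> \<le> 1" for y :: 'a
    using G by (auto simp: indicator_def)
  have int: "integrable lborel (\<lambda>y. indicator G y * h (y + c))" for c :: 'a
  proof (rule C1_compact_support_integrable[OF cont])
    fix y :: 'a assume "R + norm c \<le> norm y"
    then have "norm (y + c) \<ge> R" using norm_triangle_ineq2[of y "- c"] by simp
    then show "h (y + c) = 0" by (rule supp)
  qed (use ind in auto)
  have "(\<lambda>n. \<integral>y. indicator G y * ((h (y + s n *\<^sub>R w) - h y) / s n) \<partial>lborel)
    \<longlonglongrightarrow> (\<integral>y. indicator G y * dir_deriv h y w \<partial>lborel)"
  proof (rule integral_dominated_convergence[where w = "\<lambda>y. M * indicator (cball 0 (R + norm w)) y"])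
    show "integrable lborel (\<lambda>y::'a. M * indicator (cball 0 (R + norm w)) y)"
      by (intro integrable_mult_right integrable_real_indicator) (use emeasure_lborel_cball_finite in \<open>auto simp: top_unique\<close>)
    show "AE y in lborel. (\<lambda>n. indicator G y * ((h (y + s n *\<^sub>R w) - h y) / s n))
        \<longlonglongrightarrow> indicator G y * dir_deriv h y w"
    proof (rule AE_I2, intro tendsto_intros)
      fix y
      show "(\<lambda>n. (h (y + s n *\<^sub>R w) - h y) / s n) \<longlonglongrightarrow> dir_deriv h y w"
        using difference_quotient_LIMSEQ[of "\<lambda>s. h (y + s *\<^sub>R w)"] C1_line_derivative[OF h, of y w 0]
        by (simp add: s_def)
    qed
    show "AE y in lborel. norm (indicator G y * ((h (y + s n *\<^sub>R w) - h y) / s n))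
        \<le> M * indicator (cball 0 (R + norm w)) y" for n
    proof (rule AE_I2)
      fix y
      have sw: "norm (r *\<^sub>R w) \<le> norm w" if "0 \<le> r" "r \<le> s n" for r
        using that s[of n] by (simp add: mult_left_le_one_le)
      show "norm (indicator G y * ((h (y + s n *\<^sub>R w) - h y) / s n)) \<le> M * indicator (cball 0 (R + norm w)) y"
      proof (cases "norm y \<le> R + norm w")
        case True
        have "\<bar>h (y + s n *\<^sub>R w) - h y\<bar> \<le> M * s n"
        proof (rule M(2))
          fix r assume "0 \<le> r" "r \<le> s n"
          then show "y + r *\<^sub>R w \<in> cball 0 (R + 2 * norm w)"
            using sw[of r] True norm_triangle_ineq[of y "r *\<^sub>R w"] by simp
        qed (use s[of n] in simp)
        then have "\<bar>(h (y + s n *\<^sub>R w) - h y) / s n\<bar> \<le> M" using s[of n] by (simp add: divide_le_eq abs_divide)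
        then show ?thesis using True M(1) by (auto simp: indicator_def)
      next
        case False
        have "norm (y + s n *\<^sub>R w) \<ge> norm y - norm w"
          using norm_triangle_ineq2[of y "- s n *\<^sub>R w"] sw[of "s n"] s[of n] by simp
        then have "R \<le> norm (y + s n *\<^sub>R w)" "R \<le> norm y"
          using False norm_ge_zero[of w] by linarith+
        then have "h (y + s n *\<^sub>R w) = 0" "h y = 0" by (auto intro: supp)
        then show ?thesis using M(1) by simp
      qed
    qed
  qed (use G in measurable)
  moreover have "(\<integral>y. indicator G y * ((h (y + s n *\<^sub>R w) - h y) / s n) \<partial>lborel) =
      ((\<integral>y. indicator G y * h (y + s n *\<^sub>R w) \<partial>lborel) - (\<integral>y. indicator G y * h y \<partial>lborel)) / s n" for n
  proof -
    have "(\<integral>y. indicator G y * ((h (y + s n *\<^sub>R w) - h y) / s n) \<partial>lborel) =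
      (\<integral>y. (indicator G y * h (y + s n *\<^sub>R w) - indicator G y * h (y + 0)) / s n \<partial>lborel)"
      by (simp add: right_diff_distrib)
    also have "\<dots> = (\<integral>y. indicator G y * h (y + s n *\<^sub>R w) - indicator G y * h (y + 0) \<partial>lborel) / s n"
      by (rule integral_divide_zero)
    also have "\<dots> = ((\<integral>y. indicator G y * h (y + s n *\<^sub>R w) \<partial>lborel)
        - (\<integral>y. indicator G y * h (y + 0) \<partial>lborel)) / s n"
      using Bochner_Integration.integral_diff[OF int[of "s n *\<^sub>R w"] int[of 0]] by simp
    finally show ?thesis by simp
  qed
  ultimately show ?thesis by (simp add: s_def)
qed

lemma integral_dir_deriv_zero:
  fixes h :: "'a::euclidean_space \<Rightarrow> real"
  assumes h: "C1 h" and supp: "\<And>y. norm y \<ge> R \<Longrightarrow> h y = 0"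
  shows "(\<integral>y. dir_deriv h y w \<partial>lborel) = 0"
proof -
  have [measurable]: "h \<in> borel_measurable borel"
    using C1_continuous[OF h] by (rule borel_measurable_continuous_onI)
  have "(\<integral>y. h (y + c) \<partial>lborel) = (\<integral>y. h y \<partial>lborel)" for c by (rule integral_translate) measurable
  then have "(\<lambda>n. 0) \<longlonglongrightarrow> (\<integral>y. dir_deriv h y w \<partial>lborel)"
    using tendsto_integral_difference_quotient[OF h supp, where G = UNIV and w = w] by simp
  then show ?thesis by (simp add: LIMSEQ_const_iff)
qed

text \<open>The fundamental theorem of calculus on a half line.\<close>

lemma integral_ray_has_derivative:
  fixes k :: "real \<Rightarrow> real"
  assumes k: "continuous_on UNIV k" and supp: "\<And>t. \<bar>t\<bar> \<ge> R \<Longrightarrow> k t = 0"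
  shows "((\<lambda>x. \<integral>t. indicator {..<x} t * k t \<partial>lborel) has_real_derivative k x) (at x)"
proof -
  define a where "a = min (- R) (x - 1)"
  have ck: "continuous_on S k" for S using k continuous_on_subset by blast
  have [measurable]: "k \<in> borel_measurable borel" using k by (rule borel_measurable_continuous_onI)
  have eq: "(\<integral>t. indicator {..<z} t * k t \<partial>lborel) = integral {a..z} k" if "z > x - 1" for z
  proof -
    have "(\<integral>t. indicator {..<z} t * k t \<partial>lborel) = (LINT t:{a..z}|lborel. k t)"
      unfolding set_lebesgue_integral_def
    proof (rule integral_cong_AE)
      show "AE t in lborel. indicator {..<z} t * k t = indicator {a..z} t *\<^sub>R k t"
        using AE_lborel_singleton[of z]
      proof eventually_elim
        case (elim t)
        then show ?case using supp[of t] that by (cases "t < a") (auto simp: a_def indicator_def)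
      qed
    qed measurable
    also have "\<dots> = integral {a..z} k"
      by (rule set_borel_integral_eq_integral(2)[OF borel_integrable_atLeastAtMost'[OF ck]])
    finally show ?thesis .
  qed
  have "((\<lambda>z. integral {a..z} k) has_real_derivative k x) (at x within {a..x + 1})"
    by (rule integral_has_real_derivative[OF ck]) (auto simp: a_def)
  moreover have "x \<in> interior {a..x + 1}" by (auto simp: a_def)
  ultimately have "((\<lambda>z. integral {a..z} k) has_real_derivative k x) (at x)"
    by (metis at_within_interior)
  then show ?thesis
    by (rule has_field_derivative_transform_within_open[where S = "{x - 1<..}"]) (auto simp: eq)
qed

text \<open>Translating the integrand by \<open>r w\<close> amounts to translating the subgraph, and the translated
  subgraph is the subgraph of \<open>p \<mapsto> r (w \<bullet> e) + f (p - r w)\<close> (called \<open>g p r\<close> in the proof). On each line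
  parallel to \<open>e\<close> the integral up to the graph is thus differentiated by the chain rule, which
  produces the factor \<open>w \<bullet> e - Df w\<close>; this is the inner product of \<open>w\<close> with the non-normalised outward
  normal \<open>e - \<nabla>f\<close>. The quotients are dominated because \<open>h\<close> is bounded with compact support and
  \<open>f\<close> is Lipschitz on compact sets.\<close>

theorem gauss_green_graph:
  fixes e :: "'a::euclidean_space" and f h :: "'a \<Rightarrow> real"
  assumes e: "norm e = 1" and f: "C1 f" and inv: "\<And>y t. f (y + t *\<^sub>R e) = f y"
    and h: "C1 h" and supp: "\<And>y. norm y \<ge> R \<Longrightarrow> h y = 0"
  shows "(\<integral>y. indicator {y. y \<bullet> e < f y} y * dir_deriv h y w \<partial>lborel) =
    (\<integral>y. indicator (slab e) y * (h (hproj e y + f (hproj e y) *\<^sub>R e) *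
      (w \<bullet> e - dir_deriv f (hproj e y) w)) \<partial>lborel)"
proof -
  define G where "G = {y. y \<bullet> e < f y}"
  define s where "s n = inverse (real (Suc n))" for n
  define F where "F r y = indicator G (y - r *\<^sub>R w) * h y" for r y
  define J where "J r y = indicator (slab e) y * (\<integral>t. F r (hproj e y + t *\<^sub>R e) \<partial>lborel)" for r y
  \<comment> \<open>\<open>K p x\<close> integrates \<open>h\<close> along the line through \<open>p\<close> up to height \<open>x\<close>\<close>
  define k where "k p t = h (p + t *\<^sub>R e)" for p t
  define K where "K p x = (\<integral>t. indicator {..<x} t * k p t \<partial>lborel)" for p x
  define g where "g p r = r * (w \<bullet> e) + f (p - r *\<^sub>R w)" for p r
  have s: "0 < s n" "s n \<le> 1" for n by (auto simp: s_def inverse_le_1_iff)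
  have ee: "e \<bullet> e = 1" using e by (simp add: norm_eq_1)
  note contf = C1_continuous[OF f] and conth = C1_continuous[OF h]
  have [measurable]: "f \<in> borel_measurable borel" "h \<in> borel_measurable borel"
    using contf conth by (auto intro: borel_measurable_continuous_onI)
  have G[measurable]: "G \<in> sets borel" unfolding G_def by measurable
  have [measurable]: "F r \<in> borel_measurable borel" for r unfolding F_def by measurable
  have intF: "integrable lborel (F r)" for r
    unfolding F_def by (rule C1_compact_support_integrable[OF conth supp]) (auto simp: indicator_def)
  have intJ: "integrable lborel (J r)" and FJ: "(\<integral>y. F r y \<partial>lborel) = (\<integral>y. J r y \<partial>lborel)" for r
    unfolding J_def using integral_slices[OF e intF] by auto
  have trans: "(\<integral>y. indicator G y * h (y + r *\<^sub>R w) \<partial>lborel) = (\<integral>y. J r y \<partial>lborel)" for r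
    using integral_translate[of "F r" "r *\<^sub>R w"] FJ by (simp add: F_def)

  have pe: "hproj e y \<bullet> e = 0" for y using hproj_inner[OF e] .
  have J: "J r y = indicator (slab e) y * K (hproj e y) (g (hproj e y) r)" for r y
  proof -
    have "f (hproj e y + t *\<^sub>R e - r *\<^sub>R w) = f (hproj e y - r *\<^sub>R w)" for t
      using inv[of "hproj e y - r *\<^sub>R w" t] by (simp add: algebra_simps)
    then have "hproj e y + t *\<^sub>R e - r *\<^sub>R w \<in> G \<longleftrightarrow> t < g (hproj e y) r" for t
      by (simp add: G_def g_def inner_diff_left inner_add_left pe ee algebra_simps)
    then show ?thesis by (simp add: J_def F_def K_def k_def indicator_def)
  qed
  have norm_p: "norm (p + t *\<^sub>R e) \<ge> norm p" "norm (p + t *\<^sub>R e) \<ge> \<bar>t\<bar>" if "p \<bullet> e = 0" for p t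
  proof -
    have "(norm (p + t *\<^sub>R e))\<^sup>2 = (norm p)\<^sup>2 + t\<^sup>2"
      using that ee unfolding power2_norm_eq_inner
      by (simp add: inner_add inner_commute power2_eq_square)
    then have "(norm p)\<^sup>2 \<le> (norm (p + t *\<^sub>R e))\<^sup>2" "\<bar>t\<bar>\<^sup>2 \<le> (norm (p + t *\<^sub>R e))\<^sup>2" by auto
    then show "norm (p + t *\<^sub>R e) \<ge> norm p" "norm (p + t *\<^sub>R e) \<ge> \<bar>t\<bar>"
      by (auto intro: power2_le_imp_le)
  qed
  have K: "(K p has_real_derivative k p x) (at x)" if "p \<bullet> e = 0" for p x
    unfolding K_def
  proof (rule integral_ray_has_derivative[where R = R])
    show "continuous_on UNIV (k p)"
      unfolding k_def by (rule continuous_on_compose2[OF conth]) (auto intro!: continuous_intros)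
    show "k p t = 0" if "R \<le> \<bar>t\<bar>" for t
      unfolding k_def using norm_p(2)[OF \<open>p \<bullet> e = 0\<close>, of t] that by (intro supp) linarith
  qed
  have g': "(g p has_real_derivative (w \<bullet> e - dir_deriv f p w)) (at 0)" for p
  proof -
    have "((\<lambda>r. f (p + r *\<^sub>R (- w))) has_real_derivative dir_deriv f p (- w)) (at 0)"
      using C1_line_derivative[OF f, of p "- w" 0] by simp
    moreover have "dir_deriv f p (- w) = - dir_deriv f p w"
      by (rule linear_neg[OF C1_linear_deriv[OF f]])
    ultimately have "((\<lambda>r. f (p - r *\<^sub>R w)) has_real_derivative - dir_deriv f p w) (at 0)" by simp
    then show ?thesis unfolding g_def by (auto intro!: derivative_eq_intros)
  qed
  obtain B where B: "\<And>y. \<bar>h y\<bar> \<le> B"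
  proof -
    have "bounded (h ` cball 0 R)"
      by (intro compact_imp_bounded compact_continuous_image continuous_on_subset[OF conth]) auto
    then obtain B where "B > 0" "\<And>y. norm y \<le> R \<Longrightarrow> \<bar>h y\<bar> \<le> B" by (auto simp: bounded_pos)
    then have "\<bar>h y\<bar> \<le> B" for y using supp[of y] by (cases "norm y \<le> R") auto
    then show ?thesis using that by blast
  qed
  have B0: "B \<ge> 0" using B[of 0] by linarith
  have Klip: "\<bar>K p x - K p x'\<bar> \<le> B * \<bar>x - x'\<bar>" if "p \<bullet> e = 0" for p x x'
  proof -
    have "norm (K p x - K p x') \<le> B * norm (x - x')"
      by (rule field_differentiable_bound[of UNIV "K p" "k p"])
        (use K[OF that] B in \<open>auto simp: k_def\<close>)
    then show ?thesis by simp
  qed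
  obtain M where M: "M \<ge> 0" "\<And>y s. (\<And>r. 0 \<le> r \<Longrightarrow> r \<le> s \<Longrightarrow> y + r *\<^sub>R (- w) \<in> cball 0 (R + norm w)) \<Longrightarrow>
      0 \<le> s \<Longrightarrow> \<bar>f (y + s *\<^sub>R (- w)) - f y\<bar> \<le> M * s"
    using C1_line_lipschitz[OF f compact_cball] by metis
  define C where "C = B * (\<bar>w \<bullet> e\<bar> + M)"
  have C0: "C \<ge> 0" using B0 M(1) by (simp add: C_def)
  have bound: "\<bar>(J (s n) y - J 0 y) / s n\<bar> \<le> C * indicator (cball 0 (R + 1)) y" for n y
  proof (cases "y \<in> slab e \<and> norm (hproj e y) < R")
    case True
    let ?p = "hproj e y"
    have "\<bar>g ?p (s n) - g ?p 0\<bar> \<le> s n * (\<bar>w \<bullet> e\<bar> + M)"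
    proof -
      have "\<bar>f (?p + s n *\<^sub>R (- w)) - f ?p\<bar> \<le> M * s n"
      proof (rule M(2))
        fix r assume r: "0 \<le> r" "r \<le> s n"
        then have "norm (r *\<^sub>R (- w)) \<le> norm w" using s[of n] by (simp add: mult_left_le_one_le)
        then show "?p + r *\<^sub>R (- w) \<in> cball 0 (R + norm w)"
          using True norm_triangle_ineq[of ?p "r *\<^sub>R (- w)"] by simp
      qed (use s[of n] in simp)
      moreover have "\<bar>s n * (w \<bullet> e)\<bar> = s n * \<bar>w \<bullet> e\<bar>" using s[of n] by (simp add: abs_mult)
      moreover have "g ?p (s n) - g ?p 0 = s n * (w \<bullet> e) + (f (?p + s n *\<^sub>R (- w)) - f ?p)"
        by (simp add: g_def)
      ultimately show ?thesis by (simp add: algebra_simps)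
    qed
    then have "B * \<bar>g ?p (s n) - g ?p 0\<bar> \<le> B * (s n * (\<bar>w \<bullet> e\<bar> + M))" using B0 by (rule mult_left_mono)
    then have "\<bar>J (s n) y - J 0 y\<bar> \<le> C * s n"
      using Klip[OF pe, of y "g ?p (s n)" "g ?p 0"] True by (simp add: J C_def mult_ac)
    moreover have "norm y \<le> R + 1"
    proof -
      have "y = ?p + (y \<bullet> e) *\<^sub>R e" by (simp add: hproj_def)
      then have "norm y \<le> norm ?p + \<bar>y \<bullet> e\<bar>" by (metis norm_triangle_ineq norm_scaleR e mult.right_neutral)
      then show ?thesis using True by auto
    qed
    ultimately show ?thesis using s[of n] by (simp add: abs_divide divide_le_eq)
  next
    case False
    have "J r y = 0" for r
    proof (cases "y \<in> slab e")
      case True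
      then have "k (hproj e y) t = 0" for t
        unfolding k_def using False norm_p(1)[OF pe, of y t] by (intro supp) linarith
      then show ?thesis by (simp add: J K_def)
    qed (simp add: J)
    then show ?thesis using C0 by simp
  qed
  have "(\<lambda>n. \<integral>y. (J (s n) y - J 0 y) / s n \<partial>lborel) \<longlonglongrightarrow>
    (\<integral>y. indicator (slab e) y * (h (hproj e y + f (hproj e y) *\<^sub>R e) *
      (w \<bullet> e - dir_deriv f (hproj e y) w)) \<partial>lborel)"
  proof (rule integral_dominated_convergence[where w = "\<lambda>y. C * indicator (cball 0 (R + 1)) y"])
    have "continuous_on UNIV (\<lambda>y. f (hproj e y))"
      by (rule continuous_on_compose2[OF contf]) (auto intro!: continuous_intros)
    then have "continuous_on UNIV (\<lambda>y. h (hproj e y + f (hproj e y) *\<^sub>R e))"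
      by (intro continuous_on_compose2[OF conth]) (auto intro!: continuous_intros)
    moreover have "continuous_on UNIV (\<lambda>y. dir_deriv f (hproj e y) w)"
      by (rule continuous_on_compose2[OF C1_continuous_deriv[OF f]]) (auto intro!: continuous_intros)
    ultimately have [measurable]: "(\<lambda>y. h (hproj e y + f (hproj e y) *\<^sub>R e)) \<in> borel_measurable borel"
      "(\<lambda>y. dir_deriv f (hproj e y) w) \<in> borel_measurable borel"
      by (auto intro: borel_measurable_continuous_onI)
    show "(\<lambda>y. indicator (slab e) y * (h (hproj e y + f (hproj e y) *\<^sub>R e) *
      (w \<bullet> e - dir_deriv f (hproj e y) w))) \<in> borel_measurable lborel" by measurable
    show "(\<lambda>y. (J (s n) y - J 0 y) / s n) \<in> borel_measurable lborel" for n
      using intJ[of "s n"] intJ[of 0] by measurable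
    show "integrable lborel (\<lambda>y::'a. C * indicator (cball 0 (R + 1)) y)"
      by (intro integrable_mult_right integrable_real_indicator) (use emeasure_lborel_cball_finite in \<open>auto simp: top_unique\<close>)
    show "AE y in lborel. norm ((J (s n) y - J 0 y) / s n) \<le> C * indicator (cball 0 (R + 1)) y" for n
      using bound by simp
    show "AE y in lborel. (\<lambda>n. (J (s n) y - J 0 y) / s n) \<longlonglongrightarrow> indicator (slab e) y *
      (h (hproj e y + f (hproj e y) *\<^sub>R e) * (w \<bullet> e - dir_deriv f (hproj e y) w))"
    proof (rule AE_I2)
      fix y
      let ?p = "hproj e y"
      have "((\<lambda>r. K ?p (g ?p r)) has_real_derivative k ?p (g ?p 0) * (w \<bullet> e - dir_deriv f ?p w)) (at 0)"
        by (rule DERIV_chain2[OF K[OF pe] g'])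
      then have "(\<lambda>n. (K ?p (g ?p (s n)) - K ?p (g ?p 0)) / s n) \<longlonglongrightarrow>
          h (?p + f ?p *\<^sub>R e) * (w \<bullet> e - dir_deriv f ?p w)"
        unfolding s_def using difference_quotient_LIMSEQ by (force simp: k_def g_def)
      then have "(\<lambda>n. indicator (slab e) y * ((K ?p (g ?p (s n)) - K ?p (g ?p 0)) / s n)) \<longlonglongrightarrow>
        indicator (slab e) y * (h (?p + f ?p *\<^sub>R e) * (w \<bullet> e - dir_deriv f ?p w))"
        by (rule tendsto_mult_left)
      then show "(\<lambda>n. (J (s n) y - J 0 y) / s n) \<longlonglongrightarrow> indicator (slab e) y *
        (h (?p + f ?p *\<^sub>R e) * (w \<bullet> e - dir_deriv f ?p w))"
        by (simp add: J right_diff_distrib diff_divide_distrib)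
    qed
  qed
  moreover have "(\<integral>y. (J (s n) y - J 0 y) / s n \<partial>lborel) =
      ((\<integral>y. indicator G y * h (y + s n *\<^sub>R w) \<partial>lborel) - (\<integral>y. indicator G y * h y \<partial>lborel)) / s n" for n
    using Bochner_Integration.integral_diff[OF intJ[of "s n"] intJ[of 0]] trans[of "s n"] trans[of 0]
    by (simp add: integral_divide_zero)
  ultimately show ?thesis
    using LIMSEQ_unique tendsto_integral_difference_quotient[OF h supp G, where w = w]
    unfolding s_def G_def by force
qed

section \<open>Local description of the perimeter measure\<close>

lemma C1_compose_hproj:
  assumes "C1 f"
  shows "C1 (\<lambda>y. f (hproj e y))"
proof (rule C1I)
  have "(hproj e has_derivative hproj e) (at y)" for y
    unfolding hproj_def by (auto intro!: derivative_eq_intros)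
  from has_derivative_compose[OF this C1_has_derivative[OF assms]]
  show "((\<lambda>y. f (hproj e y)) has_derivative (\<lambda>w. dir_deriv f (hproj e y) (hproj e w))) (at y)" for y .
  show "continuous_on UNIV (\<lambda>y. dir_deriv f (hproj e y) (hproj e w))" for w
    by (rule continuous_on_compose2[OF C1_continuous_deriv[OF assms]]) (auto intro!: continuous_intros)
qed

lemma dir_deriv_translation_invariant:
  assumes "C1 f" "\<And>y. f (y + c) = f y"
  shows "dir_deriv f (y + c) = dir_deriv f y"
proof -
  have "((\<lambda>z. z + c) has_derivative (\<lambda>w. w)) (at y)" by (auto intro!: derivative_eq_intros)
  from has_derivative_compose[OF this C1_has_derivative[OF assms(1)]]
  have "(f has_derivative dir_deriv f (y + c)) (at y)" by (simp add: assms(2))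
  then show ?thesis by (rule frechet_derivative_at)
qed

lemma dir_deriv_invariant_direction:
  assumes "C1 f" "\<And>y t. f (y + t *\<^sub>R e) = f y"
  shows "dir_deriv f y e = 0"
proof -
  have "((\<lambda>t. f y) has_real_derivative dir_deriv f y e) (at 0)"
    using C1_line_derivative[OF assms(1), of y e 0] by (simp add: assms(2))
  then show ?thesis using DERIV_unique[OF _ DERIV_const] by blast
qed

lemma graph_subset_frontier:
  fixes \<Omega> :: "'a::euclidean_space set"
  assumes "open \<Omega>" "open U" and e: "norm e = 1"
    and graph: "\<Omega> \<inter> U = {y\<in>U. y \<bullet> e < F y}" and inv: "\<And>y t. F (y + t *\<^sub>R e) = F y"
    and z: "z \<in> U" "z \<bullet> e = F z"
  shows "z \<in> frontier \<Omega>"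
proof -
  have ee: "e \<bullet> e = 1" using e by (simp add: norm_eq_1)
  have "z \<notin> \<Omega>" using z graph by force
  moreover have "z \<in> closure \<Omega>"
    unfolding closure_approachable
  proof (intro allI impI)
    fix \<epsilon> :: real assume "\<epsilon> > 0"
    obtain \<delta> where \<delta>: "\<delta> > 0" "ball z \<delta> \<subseteq> U" using \<open>open U\<close> z(1) by (meson open_contains_ball)
    define t where "t = min \<epsilon> \<delta> / 2"
    have t: "t > 0" "t < \<epsilon>" "t < \<delta>" using \<open>\<epsilon> > 0\<close> \<delta>(1) by (auto simp: t_def)
    have d: "dist (z + (- t) *\<^sub>R e) z = t" using t e by (simp add: dist_norm)
    have "z + (- t) *\<^sub>R e \<in> ball z \<delta>" using d t by (simp add: dist_commute)
    moreover have "(z + (- t) *\<^sub>R e) \<bullet> e < F (z + (- t) *\<^sub>R e)"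
      unfolding inv using z(2) t ee by (simp add: inner_diff_left)
    ultimately have "z + (- t) *\<^sub>R e \<in> \<Omega>" using graph \<delta>(2) by blast
    then show "\<exists>y\<in>\<Omega>. dist y z < \<epsilon>" using d t by (intro bexI[of _ "z + (- t) *\<^sub>R e"]) auto
  qed
  ultimately show ?thesis using \<open>open \<Omega>\<close> by (simp add: frontier_def interior_open)
qed

text \<open>The vector \<open>a = e - \<nabla>F\<close> is the gradient of \<open>y \<bullet> e - F y\<close>, which near \<open>z\<close> is negative exactly inside \<open>\<Omega>\<close>.
  Each \<open>\<tau>\<close> orthogonal to \<open>a\<close> is the tangent of a curve on the graph, so the normal \<open>v\<close> is orthogonal
  to \<open>\<tau>\<close> and hence a multiple of \<open>a\<close>. The multiple is positive, since moving along \<open>- v\<close> leads into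
  \<open>\<Omega>\<close>.\<close>

lemma outward_normal_graph:
  fixes \<Omega> :: "'a::euclidean_space set"
  assumes "open \<Omega>" "open U" and e: "norm e = 1"
    and graph: "\<Omega> \<inter> U = {y\<in>U. y \<bullet> e < F y}" and inv: "\<And>y t. F (y + t *\<^sub>R e) = F y"
    and F: "C1 F" and z: "z \<in> U" "z \<bullet> e = F z"
    and a: "\<And>w. a \<bullet> w = w \<bullet> e - dir_deriv F z w"
    and out: "outward_unit_normal_at \<Omega> z v"
  shows "norm a *\<^sub>R v = a"
proof -
  define s where "s n = inverse (real (Suc n))" for n
  have s: "s n > 0" for n by (simp add: s_def)
  have s0: "s \<longlonglongrightarrow> 0" unfolding s_def by (rule LIMSEQ_inverse_real_of_nat)
  have ee: "e \<bullet> e = 1" using e by (simp add: norm_eq_1)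
  have v: "norm v = 1" using out by (simp add: outward_unit_normal_at_def unit_normal_at_def)
  have orth: "v \<bullet> \<tau> = 0" if \<tau>: "a \<bullet> \<tau> = 0" for \<tau>
  proof -
    define q where "q r = F (z + r *\<^sub>R \<tau>) - r * (\<tau> \<bullet> e)" for r
    define c where "c n = (q (s n) - q 0) / s n" for n
    have "(q has_real_derivative dir_deriv F z \<tau> - \<tau> \<bullet> e) (at 0)"
      unfolding q_def using C1_line_derivative[OF F, of z \<tau> 0] by (auto intro!: derivative_eq_intros)
    then have c: "c \<longlonglongrightarrow> 0"
      unfolding c_def s_def using difference_quotient_LIMSEQ a[of \<tau>] \<tau> by fastforce
    \<comment> \<open>the correction by \<open>c n\<close>, which tends to \<open>0\<close>, puts the point \<open>Z n\<close> on the graph\<close>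
    define T where "T n = \<tau> + c n *\<^sub>R e" for n
    define Z where "Z n = z + s n *\<^sub>R T n" for n
    have T: "T \<longlonglongrightarrow> \<tau>" unfolding T_def using tendsto_add[OF tendsto_const tendsto_scaleR[OF c tendsto_const]] by force
    have Zlim: "Z \<longlonglongrightarrow> z" unfolding Z_def using tendsto_add[OF tendsto_const tendsto_scaleR[OF s0 T]] by force
    have Z_graph: "Z n \<bullet> e = F (Z n)" for n
    proof -
      have "Z n = (z + s n *\<^sub>R \<tau>) + (s n * c n) *\<^sub>R e" by (simp add: Z_def T_def algebra_simps)
      then have "F (Z n) = F (z + s n *\<^sub>R \<tau>)" using inv by metis
      moreover have "s n * c n = q (s n) - q 0" using s[of n] by (simp add: c_def)
      ultimately show ?thesis using z(2) ee
        by (simp add: Z_def T_def inner_add_left q_def algebra_simps)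
    qed
    have "\<bar>\<tau> \<bullet> v\<bar> \<le> \<epsilon> * norm \<tau>" if "\<epsilon> > 0" for \<epsilon>
    proof -
      obtain \<delta> where \<delta>: "\<delta> > 0" "\<And>y. y \<in> frontier \<Omega> \<Longrightarrow> dist y z < \<delta> \<Longrightarrow> \<bar>(y - z) \<bullet> v\<bar> \<le> \<epsilon> * dist y z"
        using out \<open>\<epsilon> > 0\<close> unfolding outward_unit_normal_at_def unit_normal_at_def by blast
      have "\<forall>\<^sub>F n in sequentially. Z n \<in> U \<inter> ball z \<delta>"
        using topological_tendstoD[OF Zlim, of "U \<inter> ball z \<delta>"] \<open>open U\<close> z(1) \<delta>(1) by auto
      then have "\<forall>\<^sub>F n in sequentially. \<bar>T n \<bullet> v\<bar> \<le> \<epsilon> * norm (T n)"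
      proof eventually_elim
        case (elim n)
        then have "Z n \<in> frontier \<Omega>"
          using graph_subset_frontier[OF assms(1-5) _ Z_graph] by blast
        then have "\<bar>(Z n - z) \<bullet> v\<bar> \<le> \<epsilon> * dist (Z n) z" using elim \<delta>(2)[of "Z n"] by (simp add: dist_commute)
        then have "s n * \<bar>T n \<bullet> v\<bar> \<le> s n * (\<epsilon> * norm (T n))"
          using s[of n] by (simp add: Z_def dist_norm abs_mult mult_ac)
        then show ?case using s[of n] by simp
      qed
      moreover have "(\<lambda>n. \<bar>T n \<bullet> v\<bar>) \<longlonglongrightarrow> \<bar>\<tau> \<bullet> v\<bar>" "(\<lambda>n. \<epsilon> * norm (T n)) \<longlonglongrightarrow> \<epsilon> * norm \<tau>"
        by (intro tendsto_intros T)+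
      ultimately show ?thesis by (intro tendsto_le[OF sequentially_bot]) auto
    qed
    note * = this
    have pos: "0 < norm \<tau> + 1" by (simp add: add_nonneg_pos)
    have "\<bar>\<tau> \<bullet> v\<bar> \<le> 0 + \<epsilon>" if "\<epsilon> > 0" for \<epsilon>
    proof -
      have "\<bar>\<tau> \<bullet> v\<bar> \<le> \<epsilon> / (norm \<tau> + 1) * norm \<tau>"
        using that pos by (intro *) simp
      also have "\<dots> \<le> \<epsilon>"
      proof -
        have "\<epsilon> * (norm \<tau> / (norm \<tau> + 1)) \<le> \<epsilon> * 1"
          using that pos by (intro mult_left_mono) (auto simp: divide_le_eq_1)
        then show ?thesis by simp
      qed
      finally show ?thesis by simp
    qed
    then have "\<bar>\<tau> \<bullet> v\<bar> \<le> 0" by (rule field_le_epsilon)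
    then show ?thesis by (simp add: inner_commute)
  qed
  have sign: "a \<bullet> v \<ge> 0"
  proof -
    define \<phi> where "\<phi> t = F (z + t *\<^sub>R (- v)) + t * (v \<bullet> e)" for t
    have "dir_deriv F z (- v) = - dir_deriv F z v" by (rule linear_neg[OF C1_linear_deriv[OF F]])
    then have "(\<phi> has_real_derivative a \<bullet> v) (at 0)"
      unfolding \<phi>_def a using C1_line_derivative[OF F, of z "- v" 0] by (auto intro!: derivative_eq_intros)
    then have lim: "(\<lambda>n. (\<phi> (s n) - \<phi> 0) / s n) \<longlonglongrightarrow> a \<bullet> v"
      unfolding s_def by (rule difference_quotient_LIMSEQ)
    have "\<forall>\<^sub>F t in at_right 0. z - t *\<^sub>R v \<in> \<Omega>"
      using out unfolding outward_unit_normal_at_def by (auto elim: eventually_mono)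
    moreover have "filterlim s (at_right 0) sequentially"
      using s0 s by (intro filterlim_at_withinI) auto
    ultimately have "\<forall>\<^sub>F n in sequentially. z - s n *\<^sub>R v \<in> \<Omega>"
      by (rule eventually_compose_filterlim)
    moreover have "\<forall>\<^sub>F n in sequentially. z - s n *\<^sub>R v \<in> U"
    proof (rule topological_tendstoD[OF _ \<open>open U\<close> z(1)])
      show "(\<lambda>n. z - s n *\<^sub>R v) \<longlonglongrightarrow> z"
        using tendsto_diff[OF tendsto_const tendsto_scaleR[OF s0 tendsto_const]] by force
    qed
    ultimately have "\<forall>\<^sub>F n in sequentially. 0 \<le> (\<phi> (s n) - \<phi> 0) / s n"
    proof eventually_elim
      case (elim n)
      then have "(z - s n *\<^sub>R v) \<bullet> e < F (z - s n *\<^sub>R v)" using graph by blast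
      then show ?case using s[of n] z(2) by (simp add: \<phi>_def inner_diff_left)
    qed
    then show ?thesis using lim by (intro tendsto_lowerbound[OF _ _ sequentially_bot]) auto
  qed
  have "a \<bullet> e = 1" using a[of e] ee dir_deriv_invariant_direction[OF F inv] by simp
  then have a0: "a \<noteq> 0" by auto
  define l where "l = (a \<bullet> v) / (a \<bullet> a)"
  have aa: "a \<bullet> a > 0" using a0 by simp
  define \<tau> where "\<tau> = v - l *\<^sub>R a"
  have "a \<bullet> \<tau> = 0" using aa by (simp add: \<tau>_def l_def inner_diff_right)
  then have "v \<bullet> \<tau> = 0" by (rule orth)
  have "\<tau> \<bullet> \<tau> = v \<bullet> \<tau> - l * (a \<bullet> \<tau>)" by (simp add: \<tau>_def inner_diff_left)
  then have "\<tau> = 0" using \<open>a \<bullet> \<tau> = 0\<close> \<open>v \<bullet> \<tau> = 0\<close> by simp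
  then have vl: "v = l *\<^sub>R a" by (simp add: \<tau>_def)
  have "l \<ge> 0" using sign aa by (simp add: l_def)
  then have "l * norm a = 1" using v vl by (metis norm_scaleR abs_of_nonneg)
  then show ?thesis unfolding vl by (simp add: mult.commute)
qed

text \<open>Near \<open>x\<close> the perimeter measure is represented as the image under \<open>\<Psi>\<close> of the measure with
  Lebesgue density \<open>d\<close>. This is not a graph parametrisation of the boundary but a parametrisation by
  a set of full dimension, and finitely many of them are easily added up.\<close>

definition perimeter_chart ::
    "'a::euclidean_space set \<Rightarrow> ('a \<Rightarrow> 'a) \<Rightarrow> 'a \<Rightarrow> real \<Rightarrow> ('a \<Rightarrow> real) \<Rightarrow> ('a \<Rightarrow> 'a) \<Rightarrow> bool" where
  "perimeter_chart \<Omega> \<nu> x r d \<Psi> \<longleftrightarrow> 0 < r \<and> integrable lborel d \<and> (\<forall>y. 0 \<le> d y) \<and>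
     \<Psi> \<in> borel_measurable borel \<and> (\<forall>y. d y \<noteq> 0 \<longrightarrow> \<Psi> y \<in> frontier \<Omega>) \<and>
     (\<forall>h w. C1 h \<longrightarrow> (\<forall>y. y \<notin> ball x r \<longrightarrow> h y = 0) \<longrightarrow>
        (\<integral>y. indicator \<Omega> y * dir_deriv h y w \<partial>lborel) =
          (\<integral>y. d y * (h (\<Psi> y) * (\<nu> (\<Psi> y) \<bullet> w)) \<partial>lborel))"

lemma dir_deriv_zero_outside_cball:
  assumes "\<And>y. y \<notin> ball x r \<Longrightarrow> h y = 0" "y \<notin> cball x r"
  shows "dir_deriv h y w = 0"
  by (rule dir_deriv_zero_outside[of "- cball x r"]) (use assms in auto)

lemma norm_ge_outside_ball: "norm y \<ge> norm x + r \<Longrightarrow> y \<notin> ball x r"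
  using norm_triangle_ineq[of x "y - x"] by (auto simp: dist_norm norm_minus_commute)

lemma perimeter_chart_interior:
  fixes \<Omega> :: "'a::euclidean_space set"
  assumes "open \<Omega>" "x \<in> \<Omega>"
  shows "\<exists>r d \<Psi>. perimeter_chart \<Omega> \<nu> x r d \<Psi>"
proof -
  obtain r where r: "r > 0" "cball x r \<subseteq> \<Omega>" using assms by (meson open_contains_cball)
  have "(\<integral>y. indicator \<Omega> y * dir_deriv h y w \<partial>lborel) = 0"
    if h: "C1 h" "\<And>y. y \<notin> ball x r \<Longrightarrow> h y = 0" for h w
  proof -
    have eq: "(indicator \<Omega> y * dir_deriv h y w) = dir_deriv h y w" for y
      using r dir_deriv_zero_outside_cball[OF h(2)] by (cases "y \<in> cball x r") (auto simp: indicator_def)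
    have "h y = 0" if "norm y \<ge> norm x + r" for y using h(2) norm_ge_outside_ball[OF that] .
    then have "(\<integral>y. dir_deriv h y w \<partial>lborel) = 0"
      by (intro integral_dir_deriv_zero[OF h(1), of "norm x + r"]) blast
    moreover have "(\<integral>y. indicator \<Omega> y * dir_deriv h y w \<partial>lborel) = (\<integral>y. dir_deriv h y w \<partial>lborel)"
      by (rule Bochner_Integration.integral_cong[OF refl eq])
    ultimately show ?thesis by simp
  qed
  then have "perimeter_chart \<Omega> \<nu> x r (\<lambda>_. 0) (\<lambda>y. y)"
    using r(1) by (simp add: perimeter_chart_def)
  then show ?thesis by blast
qed

text \<open>In a chart, \<open>\<Psi> y\<close> is the boundary point above the projection of \<open>y\<close>, and the area element \<open>\<bar>a\<bar>\<close>
  of the graph is the density: the field \<open>a\<close> of the Gauss--Green formula is \<open>\<bar>a\<bar> \<nu>\<close>.\<close>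

lemma perimeter_chart_boundary:
  fixes \<Omega> :: "'a::euclidean_space set"
  assumes "open \<Omega>" and C1: "C1_boundary \<Omega>"
    and out: "\<And>x. x \<in> frontier \<Omega> \<Longrightarrow> outward_unit_normal_at \<Omega> x (\<nu> x)" and x: "x \<in> frontier \<Omega>"
  shows "\<exists>r d \<Psi>. perimeter_chart \<Omega> \<nu> x r d \<Psi>"
proof -
  obtain U e f where U: "open U" "x \<in> U" and e: "norm e = 1" and f: "Ck 1 f"
    and graph0: "\<Omega> \<inter> U = {y\<in>U. y \<bullet> e < f (hproj e y)}"
    using C1 x unfolding C1_boundary_def by blast
  define F where "F y = f (hproj e y)" for y
  have ee: "e \<bullet> e = 1" using e by (simp add: norm_eq_1)
  have F: "C1 F" unfolding F_def by (rule C1_compose_hproj[OF C1_if_Ck_1[OF f]])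
  have inv: "F (y + t *\<^sub>R e) = F y" for y t by (simp add: F_def hproj_add_scale[OF e])
  have graph: "\<Omega> \<inter> U = {y\<in>U. y \<bullet> e < F y}" using graph0 by (simp add: F_def)
  obtain r where r: "r > 0" "cball x r \<subseteq> U" using U by (meson open_contains_cball)
  define \<Psi> where "\<Psi> y = hproj e y + F (hproj e y) *\<^sub>R e" for y
  define a where "a y = (\<Sum>b\<in>Basis. (b \<bullet> e - dir_deriv F (hproj e y) b) *\<^sub>R b)" for y
  define d where "d y = indicator (slab e) y * indicator (ball x r) (\<Psi> y) * norm (a y)" for y
  have pe: "hproj e y \<bullet> e = 0" for y by (rule hproj_inner[OF e])
  have a: "a y \<bullet> w = w \<bullet> e - dir_deriv F (hproj e y) w" for y w
  proof -
    have "a y \<bullet> w = (\<Sum>b\<in>Basis. (w \<bullet> b) * (b \<bullet> e)) - (\<Sum>b\<in>Basis. (w \<bullet> b) * dir_deriv F (hproj e y) b)"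
      unfolding a_def inner_sum_left sum_subtractf[symmetric]
      by (intro sum.cong refl) (simp add: algebra_simps inner_commute)
    also have "(\<Sum>b\<in>Basis. (w \<bullet> b) * (b \<bullet> e)) = w \<bullet> e"
      unfolding euclidean_inner[of w e] by (intro sum.cong refl) (simp add: inner_commute)
    also have "(\<Sum>b\<in>Basis. (w \<bullet> b) * dir_deriv F (hproj e y) b) = dir_deriv F (hproj e y) w"
      using dir_deriv_Basis_sum[of F "hproj e y" w] F by (simp add: C1_def)
    finally show ?thesis .
  qed
  have "continuous_on UNIV (\<lambda>y. F (hproj e y))"
    by (rule continuous_on_compose2[OF C1_continuous[OF F]]) (auto intro!: continuous_intros)
  then have \<Psi>_cont: "continuous_on UNIV \<Psi>" unfolding \<Psi>_def by (intro continuous_intros)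
  have "continuous_on UNIV (\<lambda>y. dir_deriv F (hproj e y) b)" for b
    by (rule continuous_on_compose2[OF C1_continuous_deriv[OF F]]) (auto intro!: continuous_intros)
  then have a_cont: "continuous_on UNIV a" unfolding a_def by (intro continuous_intros)
  have \<Psi>_meas: "\<Psi> \<in> borel_measurable borel" and a_meas: "a \<in> borel_measurable borel"
    using \<Psi>_cont a_cont by (auto intro: borel_measurable_continuous_onI)
  have \<Psi>_graph: "\<Psi> y \<bullet> e = F (\<Psi> y)" for y
    using inv by (simp add: \<Psi>_def inner_add_left pe ee)
  have \<Psi>_frontier: "\<Psi> y \<in> frontier \<Omega>" if "\<Psi> y \<in> ball x r" for y
  proof (rule graph_subset_frontier[OF \<open>open \<Omega>\<close> U(1) e graph inv _ \<Psi>_graph])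
    show "\<Psi> y \<in> U" using that r(2) by auto
  qed
  have normal: "norm (a y) *\<^sub>R \<nu> (\<Psi> y) = a y" if "\<Psi> y \<in> ball x r" for y
  proof (rule outward_normal_graph[OF \<open>open \<Omega>\<close> U(1) e graph inv F _ \<Psi>_graph _ out[OF \<Psi>_frontier[OF that]]])
    show "\<Psi> y \<in> U" using that r(2) by auto
    show "a y \<bullet> w = w \<bullet> e - dir_deriv F (\<Psi> y) w" for w
      using a[of y w] dir_deriv_translation_invariant[OF F inv, of "hproj e y" "F (hproj e y)"]
      by (simp add: \<Psi>_def)
  qed
  have d_int: "integrable lborel d"
  proof (rule Bochner_Integration.integrable_bound)
    show "integrable lborel (\<lambda>y. indicator (cball 0 (norm x + r + 1)) y *\<^sub>R norm (a y))"
      by (rule borel_integrable_compact[OF compact_cball])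
        (intro continuous_intros continuous_on_subset[OF a_cont] subset_UNIV)
    have "(\<lambda>y. indicator (ball x r) (\<Psi> y) :: real) \<in> borel_measurable borel"
      by (rule measurable_compose[OF \<Psi>_meas borel_measurable_indicator[OF borel_open[OF open_ball]]])
    moreover have "(\<lambda>y. norm (a y)) \<in> borel_measurable borel"
      by (rule measurable_compose[OF a_meas]) simp
    ultimately show "d \<in> borel_measurable lborel" unfolding d_def by simp
    show "AE y in lborel. norm (d y) \<le> norm (indicator (cball 0 (norm x + r + 1)) y *\<^sub>R norm (a y))"
    proof (rule AE_I2)
      fix y
      have "norm y \<le> norm x + r + 1" if y: "y \<in> slab e" "\<Psi> y \<in> ball x r"
      proof -
        have "e \<bullet> hproj e y = 0" using pe[of y] by (simp only: inner_commute)
        then have "(norm (\<Psi> y))\<^sup>2 = (norm (hproj e y))\<^sup>2 + (F (hproj e y))\<^sup>2"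
          unfolding power2_norm_eq_inner \<Psi>_def
          by (simp add: inner_add_left inner_add_right pe ee power2_eq_square)
        then have "norm (hproj e y) \<le> norm (\<Psi> y)"
          by (intro power2_le_imp_le[OF _ norm_ge_zero]) simp
        also have "\<dots> \<le> norm x + r" using y(2) norm_ge_outside_ball[of x r "\<Psi> y"] by linarith
        finally have "norm (hproj e y) \<le> norm x + r" .
        moreover have "y = hproj e y + (y \<bullet> e) *\<^sub>R e" by (simp add: hproj_def)
        then have "norm y \<le> norm (hproj e y) + \<bar>y \<bullet> e\<bar>"
          using norm_triangle_ineq[of "hproj e y" "(y \<bullet> e) *\<^sub>R e"] e by simp
        ultimately show ?thesis using y(1) by auto
      qed
      then show "norm (d y) \<le> norm (indicator (cball 0 (norm x + r + 1)) y *\<^sub>R norm (a y))"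
        by (auto simp: d_def indicator_def)
    qed
  qed
  have "(\<integral>y. indicator \<Omega> y * dir_deriv h y w \<partial>lborel) = (\<integral>y. d y * (h (\<Psi> y) * (\<nu> (\<Psi> y) \<bullet> w)) \<partial>lborel)"
    if h: "C1 h" "\<And>y. y \<notin> ball x r \<Longrightarrow> h y = 0" for h w
  proof -
    have "indicator \<Omega> y * dir_deriv h y w = indicator {y. y \<bullet> e < F y} y * dir_deriv h y w" for y
    proof (cases "y \<in> cball x r")
      case True
      then have "y \<in> \<Omega> \<longleftrightarrow> y \<bullet> e < F y" using graph r(2) by blast
      then show ?thesis by (simp add: indicator_def)
    qed (use dir_deriv_zero_outside_cball[OF h(2)] in auto)
    then have "(\<integral>y. indicator \<Omega> y * dir_deriv h y w \<partial>lborel) =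
        (\<integral>y. indicator {y. y \<bullet> e < F y} y * dir_deriv h y w \<partial>lborel)"
      by (intro Bochner_Integration.integral_cong refl)
    also have "\<dots> = (\<integral>y. indicator (slab e) y * (h (\<Psi> y) * (w \<bullet> e - dir_deriv F (hproj e y) w)) \<partial>lborel)"
      unfolding \<Psi>_def using h norm_ge_outside_ball
      by (intro gauss_green_graph[OF e F inv h(1), of "norm x + r"]) blast
    also have "\<dots> = (\<integral>y. d y * (h (\<Psi> y) * (\<nu> (\<Psi> y) \<bullet> w)) \<partial>lborel)"
    proof (rule Bochner_Integration.integral_cong[OF refl])
      fix y
      show "indicator (slab e) y * (h (\<Psi> y) * (w \<bullet> e - dir_deriv F (hproj e y) w)) =
        d y * (h (\<Psi> y) * (\<nu> (\<Psi> y) \<bullet> w))"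
      proof (cases "\<Psi> y \<in> ball x r")
        case True
        have "norm (a y) * (\<nu> (\<Psi> y) \<bullet> w) = a y \<bullet> w"
          using arg_cong[OF normal[OF True], of "\<lambda>z. z \<bullet> w"] by simp
        then show ?thesis using True by (simp add: d_def a[of y w, symmetric])
      qed (use h(2) in simp)
    qed
    finally show ?thesis .
  qed
  then have "perimeter_chart \<Omega> \<nu> x r d \<Psi>"
    unfolding perimeter_chart_def
  proof (intro conjI allI impI)
    show "0 \<le> d y" for y by (simp add: d_def)
    show "\<Psi> y \<in> frontier \<Omega>" if "d y \<noteq> 0" for y
      using that by (intro \<Psi>_frontier) (auto simp: d_def indicator_def split: if_splits)
  qed (use r(1) d_int \<Psi>_meas in blast)+
  then show ?thesis by blast
qed

section \<open>Bounded domains with boundary of class C1 have finite perimeter\<close>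

definition bump :: "'a::euclidean_space \<Rightarrow> real \<Rightarrow> 'a \<Rightarrow> real" where
  "bump x r y = (max 0 (r\<^sup>2 - (norm (y - x))\<^sup>2))\<^sup>2"

lemma C1_bump: "C1 (bump x r)"
  unfolding bump_def by (intro C1_pos_part_square C1_const_minus C1_norm_square)

lemma bump_nonneg: "0 \<le> bump x r y"
  by (simp add: bump_def)

lemma bump_pos: "y \<in> ball x r \<Longrightarrow> 0 < bump x r y"
proof -
  assume "y \<in> ball x r"
  then have "(norm (y - x))\<^sup>2 < r\<^sup>2"
    by (intro power_strict_mono) (auto simp: dist_norm norm_minus_commute)
  then show ?thesis by (simp add: bump_def)
qed

lemma bump_zero: "0 < r \<Longrightarrow> y \<notin> ball x r \<Longrightarrow> bump x r y = 0"
  by (simp add: bump_def dist_norm norm_minus_commute power_mono)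

text \<open>The sum of the bumps is positive only near \<open>K\<close>, so it cannot serve as a denominator everywhere.
  Where it is smaller than its minimum \<open>c\<close> over \<open>K\<close>, a truncated square makes up for it, and nothing
  changes on \<open>K\<close>.\<close>

lemma C1_partition_of_unity:
  fixes K :: "'a::euclidean_space set"
  assumes "compact K" "finite I" and r: "\<And>i. i \<in> I \<Longrightarrow> 0 < r i" and cover: "K \<subseteq> (\<Union>i\<in>I. ball i (r i))"
  obtains \<zeta> where "\<And>i. C1 (\<zeta> i)" "\<And>i y. 0 \<le> \<zeta> i y"
    "\<And>i y. i \<in> I \<Longrightarrow> y \<notin> ball i (r i) \<Longrightarrow> \<zeta> i y = 0" "\<And>y. y \<in> K \<Longrightarrow> (\<Sum>i\<in>I. \<zeta> i y) = 1"
proof -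
  define S where "S y = (\<Sum>i\<in>I. bump i (r i) y)" for y
  have C1S: "C1 S" unfolding S_def by (intro C1_sum C1_bump)
  have S0: "S y \<ge> 0" for y unfolding S_def by (intro sum_nonneg bump_nonneg)
  have Spos: "S y > 0" if "y \<in> K" for y
  proof -
    obtain i where "i \<in> I" "y \<in> ball i (r i)" using cover \<open>y \<in> K\<close> by blast
    then show ?thesis
      unfolding S_def using \<open>finite I\<close> by (intro sum_pos2[of I i]) (auto intro: bump_nonneg bump_pos)
  qed
  obtain c where c: "c > 0" "\<And>y. y \<in> K \<Longrightarrow> c \<le> S y"
  proof (cases "K = {}")
    case False
    then obtain y0 where "y0 \<in> K" "\<forall>y\<in>K. S y0 \<le> S y"
      using continuous_attains_inf[OF \<open>compact K\<close> False continuous_on_subset[OF C1_continuous[OF C1S]]] by auto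
    then show ?thesis using that[of "S y0"] Spos by auto
  qed (use that[of 1] in auto)
  define T where "T y = S y + (max 0 (c - S y))\<^sup>2" for y
  have C1T: "C1 T" unfolding T_def by (intro C1_add C1_pos_part_square C1_const_minus C1S)
  have Tpos: "T y > 0" for y
  proof (cases "S y \<ge> c")
    case False
    then have "(max 0 (c - S y))\<^sup>2 > 0" by simp
    then show ?thesis unfolding T_def using S0[of y] by linarith
  qed (use c(1) in \<open>simp add: T_def\<close>)
  have TS: "T y = S y" if "y \<in> K" for y using c(2)[OF that] by (simp add: T_def)
  show ?thesis
  proof (rule that[of "\<lambda>i y. bump i (r i) y * inverse (T y)"])
    have "T y \<noteq> 0" for y using Tpos[of y] by simp
    then show "C1 (\<lambda>y. bump i (r i) y * inverse (T y))" for i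
      by (intro C1_mult C1_bump C1_inverse C1T)
    show "0 \<le> bump i (r i) y * inverse (T y)" for i y
      using bump_nonneg[of i "r i" y] Tpos[of y] by simp
    show "bump i (r i) y * inverse (T y) = 0" if "i \<in> I" "y \<notin> ball i (r i)" for i y
      using bump_zero[OF r[OF that(1)] that(2)] by simp
    show "(\<Sum>i\<in>I. bump i (r i) y * inverse (T y)) = 1" if "y \<in> K" for y
      using TS[OF that] Spos[OF that] by (simp add: sum_distrib_right[symmetric] S_def[symmetric])
  qed
qed

lemma test_function_support:
  assumes "\<psi> \<in> test_functions U"
  obtains R where "\<And>y. norm y \<ge> R \<Longrightarrow> \<psi> y = 0"
proof -
  have "bounded (closure {x. \<psi> x \<noteq> 0})" using assms compact_imp_bounded by (auto simp: test_functions_def)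
  then obtain R where R: "\<And>x. x \<in> closure {x. \<psi> x \<noteq> 0} \<Longrightarrow> norm x < R"
    unfolding bounded_pos_less by blast
  have "\<psi> y = 0" if "norm y \<ge> R" for y
    using R[of y] that closure_subset[of "{x. \<psi> x \<noteq> 0}"] by force
  then show ?thesis using that by blast
qed

lemma test_function_C1: "\<psi> \<in> test_functions U \<Longrightarrow> C1 \<psi>"
  by (rule C1_if_Ck_1) (simp add: test_functions_def)

text \<open>A partition of unity splits a test function into parts, each supported in one chart. The
  derivative of the indicator function therefore is \<open>- \<nu> \<mu>\<close>, where \<open>\<mu>\<close> is the sum of the images of
  the weighted densities of the charts. It is obtained as a single image measure, from the product of
  the counting measure on the chart centres with Lebesgue measure. The charts agree on the vector
  field \<open>\<nu>\<close>, which is why the sum of their vector measures has \<open>- \<nu>\<close> as its density.\<close>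

theorem SBV_indicator_C1_domain:
  fixes \<Omega> :: "'a::euclidean_space set"
  assumes "bounded \<Omega>" "open \<Omega>" and C1: "C1_boundary \<Omega>"
    and out: "\<And>x. x \<in> frontier \<Omega> \<Longrightarrow> outward_unit_normal_at \<Omega> x (\<nu> x)"
    and cont: "continuous_on (frontier \<Omega>) \<nu>"
  shows "SBV_with_gradient (indicator \<Omega>) (\<lambda>_. 0)"
proof -
  \<comment> \<open>\<open>\<nu>\<close> is known to be continuous on the boundary only; cutting it off makes it a Borel field\<close>
  define N where "N y = indicator (frontier \<Omega>) y *\<^sub>R \<nu> y" for y
  have N_meas: "N \<in> borel_measurable borel"
    unfolding N_def by (rule borel_measurable_continuous_on_indicator[OF _ cont]) simp
  have N_norm: "norm (N y) \<le> 1" for y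
    using out[of y] by (auto simp: N_def indicator_def outward_unit_normal_at_def unit_normal_at_def)
  have N_out: "outward_unit_normal_at \<Omega> x (N x)" if "x \<in> frontier \<Omega>" for x
    using out[OF that] that by (simp add: N_def)
  have "\<exists>r d \<Psi>. perimeter_chart \<Omega> N x r d \<Psi>" if "x \<in> closure \<Omega>" for x
  proof (cases "x \<in> \<Omega>")
    case True
    then show ?thesis by (rule perimeter_chart_interior[OF \<open>open \<Omega>\<close>])
  next
    case False
    then have "x \<in> frontier \<Omega>" using that \<open>open \<Omega>\<close> by (simp add: frontier_def interior_open)
    then show ?thesis
      using perimeter_chart_boundary[OF \<open>open \<Omega>\<close> C1 N_out, of x] by blast
  qed
  then obtain r d \<Psi> where chart: "\<And>x. x \<in> closure \<Omega> \<Longrightarrow> perimeter_chart \<Omega> N x (r x) (d x) (\<Psi> x)"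
    by metis
  have comp: "compact (closure \<Omega>)" using \<open>bounded \<Omega>\<close> by simp
  have cover: "closure \<Omega> \<subseteq> (\<Union>i\<in>closure \<Omega>. ball i (r i))"
  proof
    fix x assume "x \<in> closure \<Omega>"
    moreover from this have "x \<in> ball x (r x)" using chart[of x] by (simp add: perimeter_chart_def)
    ultimately show "x \<in> (\<Union>i\<in>closure \<Omega>. ball i (r i))" by blast
  qed
  obtain I where I: "I \<subseteq> closure \<Omega>" "finite I" "closure \<Omega> \<subseteq> (\<Union>i\<in>I. ball i (r i))"
    using compactE_image[OF comp open_ball cover] by blast
  have r: "r i > 0" and d_int: "integrable lborel (d i)" and d0: "\<And>y. 0 \<le> d i y"
    and \<Psi>: "\<Psi> i \<in> borel_measurable borel" "\<And>y. d i y \<noteq> 0 \<Longrightarrow> \<Psi> i y \<in> frontier \<Omega>"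
    and gg: "\<And>h w. C1 h \<Longrightarrow> (\<And>y. y \<notin> ball i (r i) \<Longrightarrow> h y = 0) \<Longrightarrow>
        (\<integral>y. indicator \<Omega> y * dir_deriv h y w \<partial>lborel) =
          (\<integral>y. d i y * (h (\<Psi> i y) * (N (\<Psi> i y) \<bullet> w)) \<partial>lborel)"
    if "i \<in> I" for i
    using chart[of i] I(1) that unfolding perimeter_chart_def by (blast, blast, blast, blast, blast, blast)
  obtain \<zeta> where \<zeta>: "\<And>i. C1 (\<zeta> i)" "\<And>i y. 0 \<le> \<zeta> i y"
    "\<And>i y. i \<in> I \<Longrightarrow> y \<notin> ball i (r i) \<Longrightarrow> \<zeta> i y = 0" "\<And>y. y \<in> closure \<Omega> \<Longrightarrow> (\<Sum>i\<in>I. \<zeta> i y) = 1"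
    using C1_partition_of_unity[OF comp I(2) r I(3)] by blast
  have \<zeta>1: "\<zeta> i y \<le> 1" if "y \<in> closure \<Omega>" "i \<in> I" for i y
    using member_le_sum[of i I "\<lambda>i. \<zeta> i y"] \<zeta>(2,4) that I(2) by auto
  have \<zeta>_meas: "\<zeta> i \<in> borel_measurable borel" for i
    using C1_continuous[OF \<zeta>(1)] by (rule borel_measurable_continuous_onI)

  define P where "P = count_space I \<Otimes>\<^sub>M (lborel :: 'a measure)"
  define D where "D z = d (fst z) (snd z) * \<zeta> (fst z) (\<Psi> (fst z) (snd z))" for z
  define \<Phi> where "\<Phi> z = \<Psi> (fst z) (snd z)" for z
  define \<mu> where "\<mu> = distr (density P (\<lambda>z. ennreal (D z))) borel \<Phi>"
  interpret pr: pair_sigma_finite "count_space I" "lborel :: 'a measure"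
    using I(2) by (intro pair_sigma_finite.intro sigma_finite_measure_count_space_finite sigma_finite_lborel)
  have \<Phi>_meas: "\<Phi> \<in> P \<rightarrow>\<^sub>M borel"
    unfolding P_def \<Phi>_def using I(2) \<Psi>(1)
    by (intro measurable_pair_measure_countable1) (auto intro: countable_finite)
  have D_meas: "D \<in> borel_measurable P"
    unfolding P_def
  proof (rule measurable_pair_measure_countable1)
    fix i assume i: "i \<in> I"
    have "(\<lambda>y. \<zeta> i (\<Psi> i y)) \<in> borel_measurable lborel"
      using measurable_compose[OF \<Psi>(1)[OF i] \<zeta>_meas] by simp
    then show "(\<lambda>y. D (i, y)) \<in> borel_measurable lborel"
      using d_int[OF i] by (simp add: D_def)
  qed (use I(2) in \<open>simp add: countable_finite\<close>)
  have spP: "fst z \<in> I" if "z \<in> space P" for z using that by (auto simp: P_def space_pair_measure)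
  have D0: "0 \<le> D z" if "z \<in> space P" for z
    using d0[OF spP[OF that]] \<zeta>(2) by (simp add: D_def)
  have Di: "integrable lborel (\<lambda>y. D (i, y))" if i: "i \<in> I" for i
  proof (rule Bochner_Integration.integrable_bound[OF d_int[OF i]])
    show "(\<lambda>y. D (i, y)) \<in> borel_measurable lborel"
      using D_meas measurable_Pair2[of D "count_space I" lborel borel i] i by (simp add: P_def)
    have "\<bar>D (i, y)\<bar> \<le> d i y" for y
    proof (cases "d i y = 0")
      case False
      then have "\<Psi> i y \<in> closure \<Omega>" using \<Psi>(2)[OF i] by (auto simp: frontier_def)
      then show ?thesis using \<zeta>1[OF _ i] \<zeta>(2) d0[OF i] by (simp add: D_def abs_mult mult_left_le)
    qed (simp add: D_def)
    then show "AE y in lborel. norm (D (i, y)) \<le> norm (d i y)" using d0[OF i] by simp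
  qed
  have D_int: "integrable P D"
    unfolding P_def
  proof (rule pr.Fubini_integrable)
    show "D \<in> borel_measurable (count_space I \<Otimes>\<^sub>M lborel)" using D_meas by (simp add: P_def)
    show "integrable (count_space I) (\<lambda>i. \<integral>y. norm (D (i, y)) \<partial>lborel)"
      using I(2) by (rule integrable_count_space)
    show "AE i in count_space I. integrable lborel (\<lambda>y. D (i, y))" using Di by (simp add: AE_count_space)
  qed
  have fin: "finite_measure \<mu>"
  proof (rule finite_measureI)
    have "emeasure \<mu> (space \<mu>) = (\<integral>\<^sup>+z. ennreal (D z) \<partial>P)"
      unfolding \<mu>_def using \<Phi>_meas D_meas
      by (subst emeasure_distr) (auto simp: emeasure_density intro!: nn_integral_cong)
    also have "\<dots> < \<infinity>"
      using integrableD(2)[OF D_int] D0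
      by (simp add: less_top cong: nn_integral_cong)
    finally show "emeasure \<mu> (space \<mu>) \<noteq> \<infinity>" by simp
  qed
  have integral_\<mu>: "(\<integral>x. g x \<partial>\<mu>) = (\<Sum>i\<in>I. \<integral>y. D (i, y) * g (\<Psi> i y) \<partial>lborel)"
    if g: "g \<in> borel_measurable borel" "\<And>x. \<bar>g x\<bar> \<le> B" for g :: "'a \<Rightarrow> real" and B
  proof -
    have gm: "(\<lambda>z. g (\<Phi> z)) \<in> borel_measurable P" by (rule measurable_compose[OF \<Phi>_meas g(1)])
    have "(\<integral>x. g x \<partial>\<mu>) = (\<integral>z. g (\<Phi> z) \<partial>density P (\<lambda>z. ennreal (D z)))"
      unfolding \<mu>_def using \<Phi>_meas g(1) by (intro integral_distr) auto
    also have "\<dots> = (\<integral>z. D z *\<^sub>R g (\<Phi> z) \<partial>P)"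
      using gm D_meas D0 by (intro integral_density) auto
    also have "\<dots> = (\<integral>i. \<integral>y. D (i, y) *\<^sub>R g (\<Phi> (i, y)) \<partial>lborel \<partial>count_space I)"
      unfolding P_def
    proof (rule pr.integral_fst'[symmetric])
      have "integrable P (\<lambda>z. D z *\<^sub>R g (\<Phi> z))"
      proof (rule Bochner_Integration.integrable_bound[OF integrable_mult_right[OF D_int, of B]])
        show "(\<lambda>z. D z *\<^sub>R g (\<Phi> z)) \<in> borel_measurable P" using gm D_meas by simp
        have "\<bar>D z\<bar> * \<bar>g (\<Phi> z)\<bar> \<le> \<bar>B\<bar> * \<bar>D z\<bar>" for z
          using mult_right_mono[of "\<bar>g (\<Phi> z)\<bar>" "\<bar>B\<bar>" "\<bar>D z\<bar>"] g(2)[of "\<Phi> z"] by (simp add: mult.commute)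
        then show "AE z in P. norm (D z *\<^sub>R g (\<Phi> z)) \<le> norm (B * D z)" by (simp add: abs_mult)
      qed
      then show "integrable (count_space I \<Otimes>\<^sub>M lborel) (\<lambda>z. D z *\<^sub>R g (\<Phi> z))" by (simp add: P_def)
    qed
    also have "\<dots> = (\<Sum>i\<in>I. \<integral>y. D (i, y) * g (\<Psi> i y) \<partial>lborel)"
      using I(2) by (simp add: lebesgue_integral_count_space_finite \<Phi>_def)
    finally show ?thesis .
  qed

  have AE_jump: "AE x in \<mu>. x \<in> jump_set (indicator \<Omega>)"
  proof -
    have "AE x in \<mu>. x \<in> frontier \<Omega>"
    proof -
      have "AE z in P. 0 < ennreal (D z) \<longrightarrow> \<Phi> z \<in> frontier \<Omega>"
      proof (rule AE_I2, intro impI)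
        fix z assume z: "z \<in> space P" "0 < ennreal (D z)"
        then have "d (fst z) (snd z) \<noteq> 0" by (auto simp: D_def)
        then show "\<Phi> z \<in> frontier \<Omega>" using \<Psi>(2)[OF spP[OF z(1)]] by (simp add: \<Phi>_def)
      qed
      then have "AE z in density P (\<lambda>z. ennreal (D z)). \<Phi> z \<in> frontier \<Omega>"
        using D_meas by (subst AE_density) auto
      then show ?thesis unfolding \<mu>_def using \<Phi>_meas by (subst AE_distr_iff) auto
    qed
    then show ?thesis by eventually_elim (rule frontier_jump_set[OF \<open>open \<Omega>\<close> out])
  qed

  have main: "(LINT x|lebesgue. indicator \<Omega> x * dir_deriv \<psi> x w) = (\<integral>x. \<psi> x * (N x \<bullet> w) \<partial>\<mu>)"
    if \<psi>: "\<psi> \<in> test_functions UNIV" for \<psi> w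
  proof -
    note C1\<psi> = test_function_C1[OF \<psi>]
    obtain R where R: "\<And>y. norm y \<ge> R \<Longrightarrow> \<psi> y = 0" using test_function_support[OF \<psi>] by blast
    define h where "h i y = \<zeta> i y * \<psi> y" for i y
    have C1h: "C1 (h i)" for i unfolding h_def by (rule C1_mult[OF \<zeta>(1) C1\<psi>])
    have h0: "h i y = 0" if "i \<in> I" "y \<notin> ball i (r i)" for i y using \<zeta>(3)[OF that] by (simp add: h_def)
    have \<psi>_meas: "\<psi> \<in> borel_measurable borel"
      using C1_continuous[OF C1\<psi>] by (rule borel_measurable_continuous_onI)
    have d\<psi>_meas: "(\<lambda>x. dir_deriv \<psi> x w) \<in> borel_measurable borel"
      using C1_continuous_deriv[OF C1\<psi>] by (rule borel_measurable_continuous_onI)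
    obtain B where B: "\<And>y. \<bar>\<psi> y\<bar> \<le> B"
    proof -
      have "bounded (\<psi> ` cball 0 R)"
        by (intro compact_imp_bounded compact_continuous_image continuous_on_subset[OF C1_continuous[OF C1\<psi>]]) auto
      then obtain B where "B > 0" "\<And>y. norm y \<le> R \<Longrightarrow> \<bar>\<psi> y\<bar> \<le> B" by (auto simp: bounded_pos)
      then have "\<bar>\<psi> y\<bar> \<le> B" for y using R[of y] by (cases "norm y \<le> R") auto
      then show ?thesis using that by blast
    qed
    have "(LINT x|lebesgue. indicator \<Omega> x * dir_deriv \<psi> x w) = (\<integral>x. indicator \<Omega> x * dir_deriv \<psi> x w \<partial>lborel)"
      using d\<psi>_meas \<open>open \<Omega>\<close> by (intro integral_completion) simp
    also have "\<dots> = (\<integral>x. (\<Sum>i\<in>I. indicator \<Omega> x * dir_deriv (h i) x w) \<partial>lborel)"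
    proof (rule Bochner_Integration.integral_cong[OF refl])
      fix x
      show "indicator \<Omega> x * dir_deriv \<psi> x w = (\<Sum>i\<in>I. indicator \<Omega> x * dir_deriv (h i) x w)"
      proof (cases "x \<in> \<Omega>")
        case True
        have "((\<lambda>y. \<Sum>i\<in>I. h i y) has_derivative (\<lambda>w. \<Sum>i\<in>I. dir_deriv (h i) x w)) (at x)"
          by (intro has_derivative_sum C1_has_derivative C1h)
        moreover have "(\<Sum>i\<in>I. h i y) = \<psi> y" if "y \<in> \<Omega>" for y
          using \<zeta>(4)[of y] that closure_subset[of \<Omega>] unfolding h_def sum_distrib_right[symmetric] by force
        ultimately have "(\<psi> has_derivative (\<lambda>w. \<Sum>i\<in>I. dir_deriv (h i) x w)) (at x)"
          by (rule has_derivative_transform_within_open[OF _ \<open>open \<Omega>\<close> True])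
        then have "dir_deriv \<psi> x w = (\<Sum>i\<in>I. dir_deriv (h i) x w)" by (metis frechet_derivative_at)
        then show ?thesis using True by simp
      qed simp
    qed
    also have "\<dots> = (\<Sum>i\<in>I. \<integral>x. indicator \<Omega> x * dir_deriv (h i) x w \<partial>lborel)"
    proof (rule Bochner_Integration.integral_sum)
      fix i assume i: "i \<in> I"
      show "integrable lborel (\<lambda>x. indicator \<Omega> x * dir_deriv (h i) x w)"
      proof (rule C1_compact_support_integrable[where R = "norm i + (r i + 1)"])
        show "continuous_on UNIV (\<lambda>x. dir_deriv (h i) x w)" by (rule C1_continuous_deriv[OF C1h])
        show "dir_deriv (h i) y w = 0" if "norm i + (r i + 1) \<le> norm y" for y
          using norm_ge_outside_ball[OF that]
          by (intro dir_deriv_zero_outside_cball[OF h0[OF i]]) auto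
        show "(indicator \<Omega> :: 'a \<Rightarrow> real) \<in> borel_measurable borel"
          using \<open>open \<Omega>\<close> by simp
      qed (simp add: indicator_def)
    qed
    also have "\<dots> = (\<Sum>i\<in>I. \<integral>y. D (i, y) * (\<psi> (\<Psi> i y) * (N (\<Psi> i y) \<bullet> w)) \<partial>lborel)"
      by (intro sum.cong refl, subst gg[OF _ C1h h0]) (auto simp: D_def h_def mult_ac)
    also have "\<dots> = (\<integral>x. \<psi> x * (N x \<bullet> w) \<partial>\<mu>)"
    proof (rule integral_\<mu>[symmetric])
      show "(\<lambda>x. \<psi> x * (N x \<bullet> w)) \<in> borel_measurable borel" using \<psi>_meas N_meas by simp
      show "\<bar>\<psi> x * (N x \<bullet> w)\<bar> \<le> B * norm w" for x
      proof -
        have "\<bar>N x \<bullet> w\<bar> \<le> norm (N x) * norm w" by (rule Cauchy_Schwarz_ineq2)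
        also have "\<dots> \<le> 1 * norm w" by (intro mult_right_mono N_norm) simp
        finally show ?thesis unfolding abs_mult using B[of x] by (intro mult_mono) auto
      qed
    qed
    finally show ?thesis .
  qed

  show ?thesis
    unfolding SBV_with_gradient_def
  proof (intro conjI exI[of _ \<mu>] exI[of _ "\<lambda>x. - N x"] ballI)
    show "integrable lebesgue (indicator \<Omega> :: 'a \<Rightarrow> real)"
      using lmeasurable_open[OF assms(1,2)] unfolding fmeasurable_def
      by (intro integrable_real_indicator) blast+
    show "sets \<mu> = sets borel" by (simp add: \<mu>_def)
    show "finite_measure \<mu>" by (rule fin)
    show "integrable \<mu> (\<lambda>x. - N x)"
    proof (rule finite_measure.integrable_const_bound[OF fin, of _ 1])
      show "(\<lambda>x. - N x) \<in> borel_measurable \<mu>" using N_meas by (simp add: \<mu>_def)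
    qed (use N_norm in simp)
    show "AE x in \<mu>. x \<in> jump_set (indicator \<Omega>)" by (rule AE_jump)
    show "(LINT x|lebesgue. indicator \<Omega> x * dir_deriv \<psi> x e) =
             - (LINT x|lebesgue. \<psi> x * ((0::'a) \<bullet> e)) - (LINT x|\<mu>. \<psi> x * (- N x \<bullet> e))"
      if "\<psi> \<in> test_functions UNIV" for \<psi> e
      using main[OF that, of e] by simp
  qed simp
qed

section \<open>Lipschitz boundaries\<close>

lemma C1_lipschitz_on:
  fixes f :: "'a::euclidean_space \<Rightarrow> real"
  assumes f: "C1 f" and K: "compact K" "convex K"
  obtains L where "L-lipschitz_on K f"
proof -
  have "continuous_on UNIV (\<lambda>x. \<Sum>b\<in>Basis. \<bar>dir_deriv f x b\<bar>)"
    by (intro continuous_intros C1_continuous_deriv[OF f])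
  then have "bounded ((\<lambda>x. \<Sum>b\<in>Basis. \<bar>dir_deriv f x b\<bar>) ` K)"
    using K(1) by (intro compact_imp_bounded compact_continuous_image) (auto intro: continuous_on_subset)
  then obtain L where L: "L > 0" "\<And>x. x \<in> K \<Longrightarrow> \<bar>\<Sum>b\<in>Basis. \<bar>dir_deriv f x b\<bar>\<bar> \<le> L"
    by (auto simp: bounded_pos)
  have "L-lipschitz_on K f"
  proof (rule bounded_derivative_imp_lipschitz[OF _ K(2)])
    show "(f has_derivative dir_deriv f x) (at x within K)" for x
      using C1_has_derivative[OF f] by (rule has_derivative_at_withinI)
    show "onorm (dir_deriv f x) \<le> L" if x: "x \<in> K" for x
    proof (rule onorm_le)
      fix w
      have "\<bar>dir_deriv f x w\<bar> \<le> (\<Sum>b\<in>Basis. \<bar>(w \<bullet> b) * dir_deriv f x b\<bar>)"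
        using f unfolding C1_def by (subst dir_deriv_Basis_sum) (auto intro: sum_abs)
      also have "\<dots> \<le> (\<Sum>b\<in>Basis. norm w * \<bar>dir_deriv f x b\<bar>)"
        by (intro sum_mono) (auto simp: abs_mult Basis_le_norm intro!: mult_right_mono)
      also have "\<dots> = norm w * (\<Sum>b\<in>Basis. \<bar>dir_deriv f x b\<bar>)" by (simp add: sum_distrib_left)
      also have "\<dots> \<le> norm w * L" using L(2)[OF x] by (intro mult_left_mono) auto
      finally show "norm (dir_deriv f x w) \<le> L * norm w" by (simp add: mult.commute)
    qed
  qed (use L in simp)
  then show ?thesis by (rule that)
qed

lemma dist_hproj_le: "norm e = 1 \<Longrightarrow> dist (hproj e x) (hproj e y) \<le> dist x y"
proof -
  assume e: "norm e = 1"
  define d where "d = x - y"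
  have ee: "e \<bullet> e = 1" using e by (simp add: norm_eq_1)
  have "hproj e x - hproj e y = d - (d \<bullet> e) *\<^sub>R e"
    by (simp add: hproj_def d_def inner_diff_left algebra_simps)
  moreover have "(norm (d - (d \<bullet> e) *\<^sub>R e))\<^sup>2 = (norm d)\<^sup>2 - (d \<bullet> e)\<^sup>2"
    unfolding power2_norm_eq_inner
    by (simp add: inner_diff_left inner_diff_right ee power2_eq_square inner_commute)
  then have "(norm (d - (d \<bullet> e) *\<^sub>R e))\<^sup>2 \<le> (norm d)\<^sup>2" by simp
  then have "norm (d - (d \<bullet> e) *\<^sub>R e) \<le> norm d" by (rule power2_le_imp_le) simp
  ultimately show ?thesis by (simp add: dist_norm d_def)
qed

text \<open>The charts have to be shrunk, because a function of class C1 is Lipschitz on compact sets only.\<close>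

lemma lipschitz_boundary_if_C1_boundary:
  fixes \<Omega> :: "'a::euclidean_space set"
  assumes "C1_boundary \<Omega>"
  shows "lipschitz_boundary \<Omega>"
  unfolding lipschitz_boundary_def
proof
  fix x assume "x \<in> frontier \<Omega>"
  then obtain U e f where U: "open U" "x \<in> U" and e: "norm e = 1" and f: "Ck 1 f"
    and graph: "\<Omega> \<inter> U = {y\<in>U. y \<bullet> e < f (hproj e y)}"
    using assms unfolding C1_boundary_def by blast
  obtain L where "L-lipschitz_on (cball (hproj e x) 1) f"
    using C1_lipschitz_on[OF C1_if_Ck_1[OF f] compact_cball convex_cball] by blast
  moreover have "hproj e ` (U \<inter> ball x 1) \<subseteq> cball (hproj e x) 1"
  proof
    fix p assume "p \<in> hproj e ` (U \<inter> ball x 1)"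
    then obtain y where "p = hproj e y" "dist x y < 1" by auto
    then show "p \<in> cball (hproj e x) 1" using dist_hproj_le[OF e, of x y] by simp
  qed
  ultimately have "L-lipschitz_on (hproj e ` (U \<inter> ball x 1)) f"
    by (rule lipschitz_on_subset)
  moreover have "\<Omega> \<inter> (U \<inter> ball x 1) = {y \<in> U \<inter> ball x 1. y \<bullet> e < f (hproj e y)}"
    using graph by blast
  ultimately show "\<exists>U e f L. open U \<and> x \<in> U \<and> norm e = 1 \<and> L-lipschitz_on (hproj e ` U) f \<and>
      \<Omega> \<inter> U = {y\<in>U. y \<bullet> e < f (hproj e y)}"
    using U e
    by (intro exI[of _ "U \<inter> ball x 1"] exI[of _ e] exI[of _ f] exI[of _ L] conjI)
      (simp_all add: open_Int)
qed

section \<open>The calibration\<close>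

lemma hausdorff_measure_empty: "hausdorff_measure k ({} :: 'a::euclidean_space set) = 0"
proof -
  have "hausdorff_content k \<delta> ({} :: 'a set) = 0" if "\<delta> > 0" for \<delta>
  proof -
    have "hausdorff_content k \<delta> ({} :: 'a set)
      \<le> (\<Sum>i. if ((\<lambda>_. {}) :: nat \<Rightarrow> 'a set) i = {} then 0
            else ennreal (unit_ball_vol (real k) * (diameter ({} :: 'a set) / 2) ^ k))"
      unfolding hausdorff_content_def using that by (intro INF_lower2[of "\<lambda>_. {}"]) auto
    then show ?thesis by simp
  qed
  then show ?thesis unfolding hausdorff_measure_def by (simp cong: SUP_cong_simp)
qed

lemma hausdorff_ae_if_all: "(\<And>x. x \<in> A \<Longrightarrow> P x) \<Longrightarrow> hausdorff_ae k A P"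
  unfolding hausdorff_ae_def by (metis (no_types, lifting) Collect_empty_eq hausdorff_measure_empty)

text \<open>At a point of continuity the exceptional set misses a whole ball, whatever the unit vector \<open>v\<close>.\<close>

lemma continuous_imp_approximately_regular_on:
  fixes \<phi> :: "'a::euclidean_space \<Rightarrow> 'a"
  assumes "continuous_on D \<phi>"
  shows "approximately_regular_on D \<phi>"
  unfolding approximately_regular_on_def
proof (intro allI impI hausdorff_ae_if_all)
  fix S :: "'a set" and z v and \<epsilon> :: real
  assume z: "z \<in> S \<inter> D" and v: "unit_normal_at S z v" and "\<epsilon> > 0"
  then obtain \<delta> where \<delta>: "\<delta> > 0" "\<And>y. y \<in> D \<Longrightarrow> dist y z < \<delta> \<Longrightarrow> dist (\<phi> y) (\<phi> z) < \<epsilon>"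
    using assms unfolding continuous_on_iff by blast
  have "{y\<in>D. \<bar>(\<phi> y - \<phi> z) \<bullet> v\<bar> > \<epsilon>} \<inter> ball z r = {}" if "r < \<delta>" for r
  proof -
    have "\<bar>(\<phi> y - \<phi> z) \<bullet> v\<bar> \<le> \<epsilon>" if "y \<in> D" "y \<in> ball z r" for y
      using Cauchy_Schwarz_ineq2[of "\<phi> y - \<phi> z" v] v \<delta>(2)[OF that(1)] that(2) \<open>r < \<delta>\<close>
      by (simp add: unit_normal_at_def dist_norm norm_minus_commute)
    then show ?thesis by force
  qed
  then have "\<forall>\<^sub>F r in at_right 0. measure lebesgue ({y\<in>D. \<bar>(\<phi> y - \<phi> z) \<bullet> v\<bar> > \<epsilon>} \<inter> ball z r) /
      measure lebesgue (ball z r) = 0"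
    using \<delta>(1) by (intro eventually_at_rightI[of 0 \<delta>]) auto
  then show "density_zero_at {y\<in>D. \<bar>(\<phi> y - \<phi> z) \<bullet> v\<bar> > \<epsilon>} z"
    unfolding density_zero_at_def by (rule tendsto_eventually)
qed

lemma slice_dir_deriv:
  fixes \<psi> :: "'a::euclidean_space \<times> real \<Rightarrow> real"
  assumes "\<psi> differentiable (at (x, t))"
  shows "((\<lambda>x. \<psi> (x, t)) has_derivative (\<lambda>w. dir_deriv \<psi> (x, t) (w, 0))) (at x)"
proof -
  have "((\<lambda>x. (x, t)) has_derivative (\<lambda>w. (w, 0))) (at x)"
    by (auto intro!: derivative_eq_intros)
  from has_derivative_compose[OF this assms[unfolded frechet_derivative_works]]
  show ?thesis .
qed

lemma Ck_slice:
  fixes \<psi> :: "'a::euclidean_space \<times> real \<Rightarrow> real"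
  shows "Ck k \<psi> \<Longrightarrow> Ck k (\<lambda>x. \<psi> (x, t))"
proof (induction k arbitrary: \<psi>)
  case 0
  then show ?case by (auto intro!: continuous_on_compose2[of UNIV \<psi>] continuous_intros)
next
  case (Suc k)
  then have d: "\<psi> differentiable (at z)" for z
    unfolding Ck.simps by blast
  have eq: "dir_deriv (\<lambda>x. \<psi> (x, t)) x e = dir_deriv \<psi> (x, t) (e, 0)" for x e
    using frechet_derivative_at[OF slice_dir_deriv[OF d, of t x]] by metis
  have "Ck k (\<lambda>x. dir_deriv \<psi> (x, t) (e, 0))" if "e \<in> Basis" for e
    using Suc.prems that by (intro Suc.IH[of "\<lambda>z. dir_deriv \<psi> z (e, 0)"]) (auto simp: Basis_prod_def)
  then show ?case using slice_dir_deriv[OF d] by (auto simp: eq differentiable_def)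
qed

lemma test_function_slice:
  fixes \<psi> :: "'a::euclidean_space \<times> real \<Rightarrow> real"
  assumes \<psi>: "\<psi> \<in> test_functions (U \<times> T)"
  shows "(\<lambda>x. \<psi> (x, t)) \<in> test_functions U"
proof -
  define K where "K = closure {z. \<psi> z \<noteq> 0}"
  have K: "compact K" "K \<subseteq> U \<times> T" and Ck: "Ck k \<psi>" for k
    using \<psi> by (auto simp: test_functions_def K_def)
  have "{x. \<psi> (x, t) \<noteq> 0} \<subseteq> (\<lambda>x. (x, t)) -` K"
    using closure_subset[of "{z. \<psi> z \<noteq> 0}"] by (auto simp: K_def)
  moreover have "closed ((\<lambda>x. (x, t)) -` K)"
    using K(1) by (intro closed_vimage compact_imp_closed continuous_intros)
  ultimately have sub: "closure {x. \<psi> (x, t) \<noteq> 0} \<subseteq> (\<lambda>x. (x, t)) -` K" by (rule closure_minimal)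
  have "(\<lambda>x. (x, t)) -` K \<subseteq> fst ` K" by (auto intro: rev_image_eqI)
  moreover have "bounded (fst ` K)"
    by (intro compact_imp_bounded compact_continuous_image[OF continuous_on_fst[OF continuous_on_id] K(1)])
  ultimately have "bounded (closure {x. \<psi> (x, t) \<noteq> 0})"
    using sub by (meson bounded_subset order_trans)
  moreover have "closure {x. \<psi> (x, t) \<noteq> 0} \<subseteq> U" using sub K(2) by blast
  ultimately show ?thesis
    using Ck_slice[OF Ck] by (auto simp: test_functions_def compact_eq_bounded_closed)
qed

text \<open>On each horizontal slice a test function restricts to a test function of the base, and \<open>c t\<close> is a
  constant factor there; so each slice contributes nothing to the integral.\<close>

lemma divergence_free_horizontal:
  fixes \<nu> :: "'a::euclidean_space \<Rightarrow> 'a" and c :: "real \<Rightarrow> real"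
  assumes div: "divergence_free_on U \<nu>"
    and \<nu>: "continuous_on U \<nu>" and c: "continuous_on T c"
  shows "divergence_free_on (U \<times> T) (\<lambda>z. (c (snd z) *\<^sub>R \<nu> (fst z), 0))"
  unfolding divergence_free_on_def
proof
  fix \<psi> :: "'a \<times> real \<Rightarrow> real" assume \<psi>: "\<psi> \<in> test_functions (U \<times> T)"
  define \<phi> where "\<phi> z = (c (snd z) *\<^sub>R \<nu> (fst z), 0::real)" for z
  define K where "K = closure {z. \<psi> z \<noteq> 0}"
  define G where "G z = indicator K z * dir_deriv \<psi> z (\<phi> z)" for z
  have K: "compact K" "K \<subseteq> U \<times> T" using \<psi> by (auto simp: test_functions_def K_def)
  have C1\<psi>: "C1 \<psi>" by (rule test_function_C1[OF \<psi>])
  have d: "\<psi> differentiable (at z)" for z using C1\<psi> unfolding C1_def by blast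
  have zero: "dir_deriv \<psi> z w = 0" if "z \<notin> K" for z w
    using that closure_subset[of "{z. \<psi> z \<noteq> 0}"] K(1)
    by (intro dir_deriv_zero_outside[of "- K"]) (auto simp: K_def)
  have \<phi>_cont: "continuous_on (U \<times> T) \<phi>"
    unfolding \<phi>_def
    by (intro continuous_intros continuous_on_compose2[OF c] continuous_on_compose2[OF \<nu>]) auto
  have "continuous_on K (\<lambda>z. \<Sum>b\<in>Basis. (\<phi> z \<bullet> b) * dir_deriv \<psi> z b)"
    using continuous_on_subset[OF \<phi>_cont K(2)] continuous_on_subset[OF C1_continuous_deriv[OF C1\<psi>]]
    by (intro continuous_intros) auto
  then have "continuous_on K (\<lambda>z. dir_deriv \<psi> z (\<phi> z))"
    by (simp add: dir_deriv_Basis_sum[OF d, symmetric])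
  from borel_integrable_compact[OF K(1) this]
  have G_int: "integrable (lborel \<Otimes>\<^sub>M lborel) G"
    unfolding lborel_prod G_def[abs_def] by simp
  have G_slice: "G (x, t) = c t * (indicator U x * dir_deriv (\<lambda>x. \<psi> (x, t)) x (\<nu> x))" for x t
  proof (cases "(x, t) \<in> K")
    case True
    then have x: "x \<in> U" using K(2) by auto
    have "dir_deriv (\<lambda>x. \<psi> (x, t)) x (\<nu> x) = dir_deriv \<psi> (x, t) (\<nu> x, 0)"
      using frechet_derivative_at[OF slice_dir_deriv[OF d, of t x]] by metis
    moreover have "dir_deriv \<psi> (x, t) (c t *\<^sub>R (\<nu> x, 0)) = c t * dir_deriv \<psi> (x, t) (\<nu> x, 0)"
      using linear_cmul[OF C1_linear_deriv[OF C1\<psi>], of "(x, t)" "c t" "(\<nu> x, 0)"] by simp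
    ultimately show ?thesis using True x by (simp add: G_def \<phi>_def)
  next
    case False
    have "dir_deriv (\<lambda>x. \<psi> (x, t)) x (\<nu> x) = dir_deriv \<psi> (x, t) (\<nu> x, 0)"
      using frechet_derivative_at[OF slice_dir_deriv[OF d, of t x]] by metis
    then show ?thesis using False zero by (simp add: G_def)
  qed
  have inner: "(\<integral>x. G (x, t) \<partial>lborel) = 0" for t
  proof -
    have "(\<integral>x. indicator U x * dir_deriv (\<lambda>x. \<psi> (x, t)) x (\<nu> x) \<partial>lborel) = 0"
      using div test_function_slice[OF \<psi>, of t]
      unfolding divergence_free_on_def set_lebesgue_integral_def by simp
    then show ?thesis by (simp add: G_slice)
  qed
  have "(LINT z:U \<times> T|lborel. dir_deriv \<psi> z (\<phi> z)) = (\<integral>z. G z \<partial>(lborel \<Otimes>\<^sub>M lborel))"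
    unfolding set_lebesgue_integral_def lborel_prod
    by (rule Bochner_Integration.integral_cong[OF refl]) (use K(2) zero in \<open>auto simp: G_def indicator_def\<close>)
  also have "\<dots> = (\<integral>t. \<integral>x. G (x, t) \<partial>lborel \<partial>lborel)"
    using lborel_pair.integral_snd[of "\<lambda>x t. G (x, t)"] G_int by simp
  also have "\<dots> = 0" by (simp add: inner)
  finally show "(LINT z:U \<times> T|lborel. dir_deriv \<psi> z (c (snd z) *\<^sub>R \<nu> (fst z), 0)) = 0"
    by (simp add: \<phi>_def)
qed

lemma interval_integral_linear_scaleR:
  fixes w :: "'a::euclidean_space"
  shows "(LBINT t=ereal r..ereal s. (- (2 * \<beta> * t)) *\<^sub>R w) = (\<beta> * (r\<^sup>2 - s\<^sup>2)) *\<^sub>R w"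
proof -
  have "(LBINT t=ereal r..ereal s. (- (2 * \<beta> * t)) *\<^sub>R w) = (- (\<beta> * s\<^sup>2)) *\<^sub>R w - (- (\<beta> * r\<^sup>2)) *\<^sub>R w"
  proof (rule interval_integral_FTC_finite)
    show "continuous_on {min r s..max r s} (\<lambda>t. (- (2 * \<beta> * t)) *\<^sub>R w)" by (intro continuous_intros)
    show "((\<lambda>t. (- (\<beta> * t\<^sup>2)) *\<^sub>R w) has_vector_derivative (- (2 * \<beta> * t)) *\<^sub>R w)
        (at t within {min r s..max r s})" for t
      by (auto intro!: derivative_eq_intros)
  qed
  then show ?thesis by (simp add: algebra_simps)
qed

theorem theorem3p3:
  fixes \<beta> \<gamma> :: real
    and \<Omega> :: "(real ^ 'n) set"
    and \<nu> :: "real ^ 'n \<Rightarrow> real ^ 'n"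
  assumes "\<beta> > 0" and "\<gamma> > 0"
    and "bounded \<Omega>" and "open \<Omega>" and "C1_boundary \<Omega>"
    and "\<And>x. x \<in> frontier \<Omega> \<Longrightarrow> outward_unit_normal_at \<Omega> x (\<nu> x)"
    and "continuous_on (- \<Omega>) \<nu>"
    and "\<And>x. x \<in> - \<Omega> \<Longrightarrow> norm (\<nu> x) \<le> 1"
    and "divergence_free_on (- closure \<Omega>) \<nu>"
    and "\<beta> \<le> \<gamma>"
  shows "\<exists>\<phi>. calibration \<beta> \<gamma> \<Omega> (indicator \<Omega>) \<phi>"
proof
  \<comment> \<open>the primitive \<open>\<beta> t\<^sup>2\<close> of the profile turns (b) into \<open>\<bar>s\<^sup>2 - r\<^sup>2\<bar> \<le> r\<^sup>2 + s\<^sup>2\<close>; the sign makes the field point inward, as the jump normal does\<close>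
  define \<phi> where "\<phi> z = ((- (2 * \<beta> * snd z)) *\<^sub>R \<nu> (fst z), 0::real)" for z
  have \<phi>_cont: "continuous_on ((- \<Omega>) \<times> {0..1}) \<phi>"
    unfolding \<phi>_def
    by (intro continuous_intros continuous_on_compose2[OF \<open>continuous_on (- \<Omega>) \<nu>\<close>]) auto
  have \<phi>_norm: "norm (fst (\<phi> (x, t))) \<le> 2 * \<beta> * t" if "x \<in> - \<Omega>" "0 \<le> t" for x t
  proof -
    have "norm (fst (\<phi> (x, t))) = 2 * \<beta> * t * norm (\<nu> x)"
      using that \<open>\<beta> > 0\<close> by (simp add: \<phi>_def abs_mult)
    also have "\<dots> \<le> 2 * \<beta> * t * 1"
      using that \<open>\<beta> > 0\<close> assms(8) by (intro mult_left_mono) auto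
    finally show ?thesis by simp
  qed
  have out: "x \<in> - \<Omega>" if "x \<notin> closure \<Omega>" for x using that closure_subset[of \<Omega>] by auto
  have front: "frontier \<Omega> \<subseteq> - \<Omega>" using \<open>open \<Omega>\<close> by (auto simp: frontier_def interior_open)
  show "calibration \<beta> \<gamma> \<Omega> (indicator \<Omega>) \<phi>"
    unfolding calibration_def
  proof (intro conjI)
    show "lipschitz_boundary \<Omega>" by (rule lipschitz_boundary_if_C1_boundary[OF \<open>C1_boundary \<Omega>\<close>])
    have "{x. indicator \<Omega> x \<noteq> (0::real)} = \<Omega>" by (auto simp: indicator_def)
    then show "compact (closure {x. indicator \<Omega> x \<noteq> (0::real)})"
      using \<open>bounded \<Omega>\<close> by simp
    show "\<phi> \<in> borel_measurable (restrict_space borel ((- \<Omega>) \<times> {0..1}))"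
      by (rule borel_measurable_continuous_on_restrict[OF \<phi>_cont])
    show "bounded (\<phi> ` ((- \<Omega>) \<times> {0..1}))"
      unfolding bounded_iff
    proof (intro exI[of _ "2 * \<beta>"] ballI)
      fix p assume "p \<in> \<phi> ` ((- \<Omega>) \<times> {0..1})"
      then obtain x t where xt: "x \<in> - \<Omega>" "0 \<le> t" "t \<le> 1" "p = \<phi> (x, t)" by auto
      have "norm p = norm (fst (\<phi> (x, t)))" unfolding xt by (simp add: \<phi>_def norm_Pair)
      also have "\<dots> \<le> 2 * \<beta> * t" by (rule \<phi>_norm[OF xt(1,2)])
      also have "\<dots> \<le> 2 * \<beta>" using xt \<open>\<beta> > 0\<close> by simp
      finally show "norm p \<le> 2 * \<beta>" .
    qed
    show "approximately_regular_on ((- \<Omega>) \<times> {0..1}) \<phi>"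
      by (rule continuous_imp_approximately_regular_on[OF \<phi>_cont])
    have "continuous_on (- closure \<Omega>) \<nu>"
      using out by (intro continuous_on_subset[OF \<open>continuous_on (- \<Omega>) \<nu>\<close>]) auto
    then show "divergence_free_on ((- closure \<Omega>) \<times> {0<..<1}) \<phi>"
      unfolding \<phi>_def
      by (intro divergence_free_horizontal[where c = "\<lambda>t. - (2 * \<beta> * t)"]
        \<open>divergence_free_on (- closure \<Omega>) \<nu>\<close> continuous_intros)
    show "AE x in lebesgue. x \<notin> closure \<Omega> \<longrightarrow> (\<forall>t\<in>{0..1}. snd (\<phi> (x, t)) \<ge>
        1/4 * (norm (fst (\<phi> (x, t))))\<^sup>2 - \<gamma>\<^sup>2 * indicator {0<..} t)"
    proof (rule AE_I2, intro impI ballI)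
      fix x and t :: real assume x: "x \<notin> closure \<Omega>" and t: "t \<in> {0..1}"
      have "norm (fst (\<phi> (x, t))) \<le> 2 * \<beta> * t" using \<phi>_norm[OF out[OF x]] t by simp
      also have "\<dots> \<le> 2 * \<gamma> * indicator {0<..} t"
      proof (cases "t = 0")
        case False
        have "\<beta> * t \<le> \<beta> * 1" using t \<open>\<beta> > 0\<close> by (intro mult_left_mono) auto
        then show ?thesis using False t \<open>\<beta> \<le> \<gamma>\<close> by simp
      qed simp
      finally have "(norm (fst (\<phi> (x, t))))\<^sup>2 \<le> (2 * \<gamma> * indicator {0<..} t)\<^sup>2"
        by (intro power_mono) auto
      also have "\<dots> = 4 * \<gamma>\<^sup>2 * indicator {0<..} t" by (simp add: power_mult_distrib indicator_def)
      finally show "snd (\<phi> (x, t)) \<ge> 1/4 * (norm (fst (\<phi> (x, t))))\<^sup>2 - \<gamma>\<^sup>2 * indicator {0<..} t"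
        by (simp add: \<phi>_def)
    qed
    have int: "(LBINT t=ereal r..ereal s. fst (\<phi> (x, t))) = (\<beta> * (r\<^sup>2 - s\<^sup>2)) *\<^sub>R \<nu> x" for r s x
      using interval_integral_linear_scaleR[of r s \<beta> "\<nu> x"] by (simp add: \<phi>_def)
    show "hausdorff_ae (DIM(real ^ 'n) - 1) (- \<Omega>) (\<lambda>x. \<forall>r\<in>{0..1}. \<forall>s\<in>{0..1}.
        norm (LBINT t=ereal r..ereal s. fst (\<phi> (x, t))) \<le> \<beta> * (r\<^sup>2 + s\<^sup>2))"
    proof (intro hausdorff_ae_if_all ballI)
      fix x and r s :: real assume x: "x \<in> - \<Omega>"
      have "norm ((\<beta> * (r\<^sup>2 - s\<^sup>2)) *\<^sub>R \<nu> x) \<le> \<beta> * \<bar>r\<^sup>2 - s\<^sup>2\<bar> * 1"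
        unfolding norm_scaleR abs_mult using \<open>\<beta> > 0\<close> assms(8)[OF x] by (intro mult_mono) auto
      also have "\<dots> \<le> \<beta> * (r\<^sup>2 + s\<^sup>2)"
        using \<open>\<beta> > 0\<close> by (simp add: abs_le_iff)
      finally show "norm (LBINT t=ereal r..ereal s. fst (\<phi> (x, t))) \<le> \<beta> * (r\<^sup>2 + s\<^sup>2)"
        unfolding int .
    qed
    show "\<exists>g. SBV_with_gradient (indicator \<Omega>) g \<and> (AE x in lebesgue. x \<notin> closure \<Omega> \<longrightarrow>
        fst (\<phi> (x, indicator \<Omega> x)) = 2 *\<^sub>R g x \<and>
        snd (\<phi> (x, indicator \<Omega> x)) = (norm (g x))\<^sup>2 - \<gamma>\<^sup>2 * indicator {0<..} (indicator \<Omega> x :: real))"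
    proof (intro exI[of _ "\<lambda>_. 0"] conjI AE_I2 impI)
      show "SBV_with_gradient (indicator \<Omega>) (\<lambda>_. 0)"
        by (rule SBV_indicator_C1_domain[OF assms(3-6)
            continuous_on_subset[OF \<open>continuous_on (- \<Omega>) \<nu>\<close> front]])
      fix x assume "x \<notin> closure \<Omega>"
      then have "indicator \<Omega> x = (0::real)" using out by simp
      then show "fst (\<phi> (x, indicator \<Omega> x)) = 2 *\<^sub>R 0"
        and "snd (\<phi> (x, indicator \<Omega> x)) =
          (norm (0 :: real ^ 'n))\<^sup>2 - \<gamma>\<^sup>2 * indicator {0<..} (indicator \<Omega> x :: real)"
        by (simp_all add: \<phi>_def)
    qed
    show "hausdorff_ae (DIM(real ^ 'n) - 1) (jump_set (indicator \<Omega>))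
      (\<lambda>x. \<forall>a b v. jump_at (indicator \<Omega>) x a b v \<longrightarrow>
        (LBINT t=ereal a..ereal b. fst (\<phi> (x, t))) = (\<beta> * (a\<^sup>2 + b\<^sup>2)) *\<^sub>R v)"
    proof (intro hausdorff_ae_if_all allI impI)
      fix x a b v assume "jump_at (indicator \<Omega>) x a b v"
      then have "a = 0 \<and> b = 1 \<and> v = - \<nu> x"
        by (intro jump_at_indicatorD[OF \<open>open \<Omega>\<close>] assms(6))
      then show "(LBINT t=ereal a..ereal b. fst (\<phi> (x, t))) = (\<beta> * (a\<^sup>2 + b\<^sup>2)) *\<^sub>R v"
        unfolding int by simp
    qed
  qed (use \<open>bounded \<Omega>\<close> \<open>open \<Omega>\<close> in \<open>auto simp: indicator_def\<close>)
qed

end
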